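(* Let $\Omega=\{\lambda\in\mathbb{C}: 1/2<\Re\lambda<3/2\}$ with distinguished point $\lambda_0=1$, let $\zeta$ be the Riemann zeta function, and consider the mapping $$f:\Omega\times\mathbb{C}\to\overline{\mathbb{C}},\qquad f(\lambda,z)=z+\frac{1}{\zeta(\lambda)}.$$ The following are equivalent: a) the Riemann Hypothesis holds; b) $f$ is a holomorphic motion (of $\mathbb{C}$ in $\overline{\mathbb{C}}$, parametrized by $\Omega$ with base point $1$); c) $f$ is a holomorphic motion in $\mathbb{C}$ (of $\mathbb{C}$, parametrized by $\Omega$ with base point $1$).
   Context: $\overline{\mathbb{C}}=\mathbb{C}\cup\{\infty\}$ is the Riemann sphere. The function $1/\zeta$ is regarded as a holomorphic map $\Omega\to\overline{\mathbb{C}}$: it takes the value $0$ at the pole $\lambda=1$ of $\zeta$ and the value $\infty$ at zeros of $\zeta$; by convention $z+\infty=\infty$ for $z\in\mathbb{C}$. Let $W$ be a complex manifold with distinguished point $\lambda_0$ and let $E\subset\overline{\mathbb{C}}$. A holomorphic motion of $E$ in $\overline{\mathbb{C}}$, parametrized by $W$ with base point $\lambda_0$, is a map $f:W\times E\to\overline{\mathbb{C}}$ such that: (1) $f(\lambda_0,z)=z$ for all $z\in E$; (2) for every fixed $\lambda\in W$, the map $z\mapsto f(\lambda,z)$ is injective on $E$; (3) for every fixed $z\in E$, the map $\lambda\mapsto f(\lambda,z)$ is a holomorphic map from $W$ to $\overline{\mathbb{C}}$. If $E\subset\mathbb{C}$, a holomorphic motion of $E$ in $\mathbb{C}$ is a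 map $f:W\times E\to\mathbb{C}$ (i.e. taking only finite values) with the same three properties. The Riemann Hypothesis is the statement that all zeros of $\zeta$ in the strip $0<\Re\lambda<1$ lie on the line $\Re\lambda=1/2$. *)

theory Defs
  imports "HOL-Complex_Analysis.Complex_Analysis"
begin

section \<open>The Riemann sphere\<close>

datatype riemann_sphere = Finite complex | Infinity

abbreviation plane :: "riemann_sphere set" where
  "plane \<equiv> range Finite"

fun sphere_inverse :: "riemann_sphere \<Rightarrow> riemann_sphere" where
  "sphere_inverse (Finite z) = (if z = 0 then Infinity else Finite (1 / z))"
| "sphere_inverse Infinity = Finite 0"

text \<open>The value at \<open>(Infinity, Infinity)\<close> is arbitrary and is never used below.\<close>

fun sphere_add :: "riemann_sphere \<Rightarrow> riemann_sphere \<Rightarrow> riemann_sphere" where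
  "sphere_add (Finite z) (Finite w) = Finite (z + w)"
| "sphere_add (Finite z) Infinity = Infinity"
| "sphere_add Infinity q = Infinity"

text \<open>
  The complex structure is given by the charts \<open>z\<close> on the plane and \<open>1/z\<close> on the
  complement of \<open>0\<close>: the map must be holomorphic near each point when read in one of them.
  Continuity of the map follows.
\<close>

definition holomorphic_to_sphere :: "(complex \<Rightarrow> riemann_sphere) \<Rightarrow> complex set \<Rightarrow> bool" where
  "holomorphic_to_sphere g W \<longleftrightarrow>
     (\<forall>w\<in>W. \<exists>U h. open U \<and> w \<in> U \<and> U \<subseteq> W \<and> h holomorphic_on U \<and>
        ((\<forall>u\<in>U. g u = Finite (h u)) \<or> (\<forall>u\<in>U. sphere_inverse (g u) = Finite (h u))))"

lemma holomorphic_to_sphere_Finite_iff: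
  assumes "open W"
  shows "holomorphic_to_sphere (\<lambda>w. Finite (h w)) W \<longleftrightarrow> h holomorphic_on W"
proof
  assume "h holomorphic_on W"
  with assms show "holomorphic_to_sphere (\<lambda>w. Finite (h w)) W"
    unfolding holomorphic_to_sphere_def by blast
next
  assume L: "holomorphic_to_sphere (\<lambda>w. Finite (h w)) W"
  have "\<exists>U. open U \<and> w \<in> U \<and> h holomorphic_on U" if "w \<in> W" for w
  proof -
    obtain U k where U: "open U" "w \<in> U" "k holomorphic_on U"
      and "(\<forall>u\<in>U. Finite (h u) = Finite (k u)) \<or>
           (\<forall>u\<in>U. sphere_inverse (Finite (h u)) = Finite (k u))"
      using L \<open>w \<in> W\<close> unfolding holomorphic_to_sphere_def by blast
    then consider "\<forall>u\<in>U. h u = k u" | "\<forall>u\<in>U. h u \<noteq> 0 \<and> k u = 1 / h u"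
      by (force split: if_splits)
    then have "h holomorphic_on U"
    proof cases
      case 1
      then show ?thesis using U by (metis holomorphic_transform)
    next
      case 2
      then have inv: "k u \<noteq> 0 \<and> h u = 1 / k u" if "u \<in> U" for u
        using that by simp
      then have "(\<lambda>u. 1 / k u) holomorphic_on U"
        using U by (intro holomorphic_intros) auto
      with inv show ?thesis by (metis (no_types, lifting) holomorphic_transform)
    qed
    with U show ?thesis by blast
  qed
  then have "h analytic_on W"
    by (meson analytic_at analytic_on_analytic_at)
  then show "h holomorphic_on W"
    by (rule analytic_imp_holomorphic)
qed


section \<open>Holomorphic motions\<close>

text \<open>The parameter manifold is an open subset of the complex plane.\<close>

definition holomorphic_motion ::
    "complex set \<Rightarrow> complex \<Rightarrow> riemann_sphere set \<Rightarrow>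
     (complex \<Rightarrow> riemann_sphere \<Rightarrow> riemann_sphere) \<Rightarrow> bool" where
  "holomorphic_motion W l0 E f \<longleftrightarrow>
     open W \<and> l0 \<in> W \<and>
     (\<forall>z\<in>E. f l0 z = z) \<and>
     (\<forall>l\<in>W. inj_on (f l) E) \<and>
     (\<forall>z\<in>E. holomorphic_to_sphere (\<lambda>l. f l z) W)"

text \<open>
  By \<open>holomorphic_to_sphere_Finite_iff\<close>, for finite values holomorphy as a map to the sphere
  is ordinary holomorphy.
\<close>

definition holomorphic_motion_in_plane ::
    "complex set \<Rightarrow> complex \<Rightarrow> riemann_sphere set \<Rightarrow>
     (complex \<Rightarrow> riemann_sphere \<Rightarrow> riemann_sphere) \<Rightarrow> bool" where
  "holomorphic_motion_in_plane W l0 E f \<longleftrightarrow>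
     E \<subseteq> plane \<and> (\<forall>l\<in>W. \<forall>z\<in>E. f l z \<in> plane) \<and> holomorphic_motion W l0 E f"


section \<open>The Riemann zeta function\<close>

text \<open>
  The analytic continuation of the Dirichlet series to the plane without \<open>1\<close>. The value \<open>0\<close>
  at the pole only makes the function unique; the value of zeta there as a map to the sphere
  is set in \<open>zeta_sphere\<close>.
\<close>

definition zeta :: "complex \<Rightarrow> complex" where
  "zeta = (THE h. h holomorphic_on (- {1}) \<and>
             (\<forall>s. Re s > 1 \<longrightarrow> (\<lambda>n. of_nat (Suc n) powr (- s)) sums h s) \<and>
             h 1 = 0)"

definition zeta_sphere :: "complex \<Rightarrow> riemann_sphere" where
  "zeta_sphere s = (if s = 1 then Infinity else Finite (zeta s))"

definition Riemann_Hypothesis :: bool where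
  "Riemann_Hypothesis \<longleftrightarrow>
     (\<forall>s. 0 < Re s \<and> Re s < 1 \<and> zeta s = 0 \<longrightarrow> Re s = 1 / 2)"

definition Omega :: "complex set" where
  "Omega = {l. 1 / 2 < Re l \<and> Re l < 3 / 2}"

definition zeta_motion :: "complex \<Rightarrow> riemann_sphere \<Rightarrow> riemann_sphere" where
  "zeta_motion l z = sphere_add z (sphere_inverse (zeta_sphere l))"

end

theory Submission
  imports Defs "HOL-Computational_Algebra.Primes"
begin

text \<open>
  Adding the constant \<open>1 / zeta\<close> is injective on the plane exactly when that constant is finite, so
  each of the two motion statements says that zeta has no zero with real part between 1/2 and 3/2.
  The zeros with real part at least 1 are excluded by the Euler product and Mertens' 3-4-1
  inequality, and those with real part below 1/2 are carried over by the functional equation.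

  The continuation to \<open>Re s > -1\<close> comes from comparing each \<open>n\<^sup>-\<^sup>s\<close> with the trapezoidal rule for the
  integral of \<open>y\<^sup>-\<^sup>s\<close>. For real \<open>s\<close> between -1 and 0 all quantities involved are nonnegative, and
  integrating \<open>(y - n) (n + 1 - y) / 2 * x\<^sup>s\<^sup>+\<^sup>1 * exp (- x y)\<close> in both orders and summing over \<open>n\<close> gives
  \[ \Gamma(s) \zeta(s) = \int_0^\infty x^{s-1}
       \Bigl( \frac{1}{e^x - 1} - \frac{1}{x} + \frac{1}{2} \Bigr) dx. \]
  The partial fractions of the bracket, integrated term by term, turn the right-hand side into a
  multiple of \<open>zeta (1 - s)\<close>. The identity theorem extends this to \<open>-1 < Re s < 1\<close>, and the functional
  equation then also supplies the continuation to the rest of the plane.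
\<close>


section \<open>Continuation of zeta to the right of -1\<close>

text \<open>Peano kernel of the trapezoidal rule.\<close>

lemma trapezoid_has_integral:
  fixes F f f' f'' :: "real \<Rightarrow> 'a :: banach"
  assumes cont: "continuous_on {a..a+1} F" "continuous_on {a..a+1} f"
      "continuous_on {a..a+1} (\<lambda>y. ((y - a) * (a + 1 - y)) *\<^sub>R f' y)"
    and F: "\<And>y. a < y \<Longrightarrow> y < a + 1 \<Longrightarrow> (F has_vector_derivative f y) (at y)"
    and f: "\<And>y. a < y \<Longrightarrow> y < a + 1 \<Longrightarrow> (f has_vector_derivative f' y) (at y)"
    and f': "\<And>y. a < y \<Longrightarrow> y < a + 1 \<Longrightarrow> (f' has_vector_derivative f'' y) (at y)"
  shows "((\<lambda>y. ((y - a) * (a + 1 - y) / 2) *\<^sub>R f'' y) has_integral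
           ((1/2) *\<^sub>R (f a + f (a + 1)) - (F (a + 1) - F a))) {a..a+1}"
proof -
  \<comment> \<open>With \<open>p = (y - a) * (a + 1 - y)\<close>, this is
    \<open>(p * f' - p' * f + p'' * F) / 2\<close>, the result of integrating
    \<open>p * f'' / 2\<close> by parts twice. Continuity is asked of \<open>p * f'\<close> instead
    of \<open>f'\<close>, since \<open>f'\<close> may blow up at an endpoint where \<open>p\<close>
    vanishes.\<close>
  define H where "H = (\<lambda>y. (1/2) *\<^sub>R (((y - a) * (a + 1 - y)) *\<^sub>R f' y
                              - (2 * a + 1 - 2 * y) *\<^sub>R f y - 2 *\<^sub>R F y))"
  have "((\<lambda>y. ((y - a) * (a + 1 - y) / 2) *\<^sub>R f'' y) has_integral (H (a + 1) - H a)) {a..a+1}"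
  proof (rule fundamental_theorem_of_calculus_interior)
    show "continuous_on {a..a+1} H"
      unfolding H_def by (intro continuous_intros cont)
    fix y assume "y \<in> {a<..<a+1}"
    then have y: "a < y" "y < a + 1" by auto
    have p: "((\<lambda>y. (y - a) * (a + 1 - y)) has_field_derivative (2 * a + 1 - 2 * y)) (at y)"
      by (auto intro!: derivative_eq_intros simp: algebra_simps)
    have q: "((\<lambda>y. 2 * a + 1 - 2 * y) has_field_derivative (- 2)) (at y)"
      by (auto intro!: derivative_eq_intros)
    have "(H has_vector_derivative
             (1/2) *\<^sub>R ((((y - a) * (a + 1 - y)) *\<^sub>R f'' y + (2 * a + 1 - 2 * y) *\<^sub>R f' y)
               - ((2 * a + 1 - 2 * y) *\<^sub>R f' y + (-2) *\<^sub>R f y) - 2 *\<^sub>R f y)) (at y)"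
      unfolding H_def
      by (rule bounded_linear.has_vector_derivative[OF bounded_linear_scaleR_right],
          rule has_vector_derivative_diff, rule has_vector_derivative_diff,
          rule has_vector_derivative_scaleR[OF p f'[OF y]], rule has_vector_derivative_scaleR[OF q f[OF y]],
          rule bounded_linear.has_vector_derivative[OF bounded_linear_scaleR_right F[OF y]])
    then show "(H has_vector_derivative ((y - a) * (a + 1 - y) / 2) *\<^sub>R f'' y) (at y)"
      by simp
  qed simp
  also have "H (a + 1) - H a = (1/2) *\<^sub>R (f a + f (a + 1)) - (F (a + 1) - F a)"
    by (simp add: H_def scaleR_right_diff_distrib scaleR_add_right)
  finally show ?thesis .
qed

text \<open>
  The trapezoidal error of \<open>y\<^sup>-\<^sup>s\<close> on \<open>[n, n + 1]\<close>, multiplied by \<open>s - 1\<close> to remove the pole at 1. Hence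
  \<open>zeta_reg s\<close> is \<open>(s - 1) * zeta s\<close>.
\<close>

definition zeta_term :: "nat \<Rightarrow> complex \<Rightarrow> complex" where
  "zeta_term n s = (s - 1) * (of_nat n powr (- s) + of_nat (Suc n) powr (- s)) / 2
                     + (of_nat (Suc n) powr (1 - s) - of_nat n powr (1 - s))"

text \<open>The trapezoidal errors from 1 on give the first Dirichlet term only half weight and
  subtract the integral over \<open>[1, \<infinity>)\<close>. After multiplication by
  \<open>s - 1\<close> these defects are \<open>(s - 1) / 2\<close> and 1, which add up to
  \<open>(s + 1) / 2\<close>.\<close>

definition zeta_reg :: "complex \<Rightarrow> complex" where
  "zeta_reg s = (s + 1) / 2 + (\<Sum>n. zeta_term (Suc n) s)"

lemma has_vector_derivative_powr_real:
  fixes y :: real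
  assumes "y > 0"
  shows "((\<lambda>y. of_real y powr s :: complex) has_vector_derivative s * of_real y powr (s - 1)) (at y)"
proof -
  have "((\<lambda>z. z powr s) has_field_derivative s * complex_of_real y powr (s - 1)) (at (of_real y))"
    by (rule has_field_derivative_powr) (use assms in auto)
  from has_vector_derivative_real_field[OF this] show ?thesis .
qed

lemma zeta_term_has_integral:
  assumes "n \<ge> 1"
  shows "((\<lambda>y. ((y - real n) * (real n + 1 - y) / 2) *\<^sub>R
             ((s - 1) * s * (s + 1) * of_real y powr (- s - 2))) has_integral zeta_term n s)
         {real n..real n + 1}"
proof -
  \<comment> \<open>The antiderivative of \<open>(s - 1) * y powr (- s)\<close> is
    \<open>- (y powr (1 - s))\<close>, with no division by \<open>s - 1\<close>, so that
    \<open>s = 1\<close> is no exception.\<close>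
  let ?F = "\<lambda>y. - (of_real y powr (1 - s)) :: complex"
  let ?f = "\<lambda>y. (s - 1) * of_real y powr (- s) :: complex"
  let ?f' = "\<lambda>y. - (s - 1) * s * of_real y powr (- s - 1) :: complex"
  let ?f'' = "\<lambda>y. (s - 1) * s * (s + 1) * of_real y powr (- s - 2) :: complex"
  let ?n = "real n"
  have F: "(?F has_vector_derivative ?f y) (at y)" if "y > 0" for y
    using has_vector_derivative_minus[OF has_vector_derivative_powr_real[OF that, of "1 - s"]]
    by (simp add: algebra_simps)
  have f: "(?f has_vector_derivative ?f' y) (at y)" if "y > 0" for y
    using has_vector_derivative_mult_right[OF has_vector_derivative_powr_real[OF that, of "- s"], of "s - 1"]
    by (simp add: algebra_simps)
  have f': "(?f' has_vector_derivative ?f'' y) (at y)" if "y > 0" for y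
    using has_vector_derivative_mult_right[OF has_vector_derivative_powr_real[OF that, of "- s - 1"], of "- (s - 1) * s"]
    by (simp add: algebra_simps)
  have cont: "continuous_on {?n..?n+1} (\<lambda>y. complex_of_real y powr r)" for r
  proof (intro continuous_at_imp_continuous_on ballI)
    fix y assume "y \<in> {?n..?n+1}"
    then have "y > 0" using assms by auto
    from has_vector_derivative_continuous[OF has_vector_derivative_powr_real[OF this]]
    show "isCont (\<lambda>y. complex_of_real y powr r) y" .
  qed
  have "((\<lambda>y. ((y - ?n) * (?n + 1 - y) / 2) *\<^sub>R ?f'' y) has_integral
           ((1/2) *\<^sub>R (?f ?n + ?f (?n + 1)) - (?F (?n + 1) - ?F ?n))) {?n..?n+1}"
  proof (rule trapezoid_has_integral[where f' = ?f'])
    fix y assume "?n < y" "y < ?n + 1"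
    then have "y > 0" using assms by simp
    then show "(?F has_vector_derivative ?f y) (at y)" "(?f has_vector_derivative ?f' y) (at y)"
      "(?f' has_vector_derivative ?f'' y) (at y)"
      by (fact F f f')+
  qed (intro continuous_intros cont)+
  also have "(1/2) *\<^sub>R (?f ?n + ?f (?n + 1)) - (?F (?n + 1) - ?F ?n) = zeta_term n s"
    by (simp add: zeta_term_def scaleR_conv_of_real field_simps)
  finally show ?thesis .
qed

text \<open>Two differentiations gain a factor of order \<open>n\<close> to the power -2 over the
  Dirichlet terms. The resulting exponent is below -1 precisely when
  \<open>Re s > - 1\<close>.\<close>

lemma norm_zeta_term_le:
  assumes "n \<ge> 1" "Re s \<ge> - 2"
  shows "norm (zeta_term n s) \<le> norm ((s - 1) * s * (s + 1)) * real n powr (- Re s - 2)"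
proof -
  have "norm (zeta_term n s) \<le>
          (norm ((s - 1) * s * (s + 1)) * real n powr (- Re s - 2)) * measure lborel (cbox (real n) (real n + 1))"
  proof (rule has_integral_bound)
    show "((\<lambda>y. ((y - real n) * (real n + 1 - y) / 2) *\<^sub>R
             ((s - 1) * s * (s + 1) * of_real y powr (- s - 2))) has_integral zeta_term n s)
           (cbox (real n) (real n + 1))"
      using zeta_term_has_integral[OF assms(1)] by simp
  next
    fix y :: real assume "y \<in> cbox (real n) (real n + 1)"
    then have y: "real n \<le> y" "y \<le> real n + 1" by auto
    have "(y - real n) * (real n + 1 - y) \<le> 1 * 1"
      using y by (intro mult_mono) auto
    then have 1: "(y - real n) * (real n + 1 - y) / 2 \<le> 1" by simp
    have 2: "norm (of_real y powr (- s - 2) :: complex) \<le> real n powr (- Re s - 2)"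
      using y assms by (auto simp: norm_powr_real_powr intro!: powr_mono2')
    have "norm (((y - real n) * (real n + 1 - y) / 2) *\<^sub>R
             ((s - 1) * s * (s + 1) * of_real y powr (- s - 2))) =
          (y - real n) * (real n + 1 - y) / 2 *
             (norm ((s - 1) * s * (s + 1)) * norm (of_real y powr (- s - 2) :: complex))"
      using y by (simp add: norm_mult)
    also have "\<dots> \<le> 1 * (norm ((s - 1) * s * (s + 1)) * real n powr (- Re s - 2))"
      using y 1 2 by (intro mult_mono) auto
    finally show "norm (((y - real n) * (real n + 1 - y) / 2) *\<^sub>R
             ((s - 1) * s * (s + 1) * of_real y powr (- s - 2))) \<le>
          norm ((s - 1) * s * (s + 1)) * real n powr (- Re s - 2)" by simp
  qed auto
  then show ?thesis by simp
qed

lemma zeta_term_uniform_limit: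
  assumes "Re s > - 1"
  shows "\<exists>d>0. cball s d \<subseteq> {s. Re s > - 1} \<and>
           uniform_limit (cball s d) (\<lambda>N s. \<Sum>n<N. zeta_term (Suc n) s)
             (\<lambda>s. \<Sum>n. zeta_term (Suc n) s) sequentially"
proof -
  \<comment> \<open>Half the distance to the line \<open>Re s = - 1\<close>: on the disc real parts
    are at least \<open>d - 1\<close>, so the exponent \<open>- Re z - 2\<close> is at most
    \<open>- 1 - d\<close>.\<close>
  define d where "d = (Re s + 1) / 2"
  have d: "d > 0" using assms by (simp add: d_def)
  have Re: "Re z \<ge> d - 1" if "z \<in> cball s d" for z
  proof -
    have "\<bar>Re (s - z)\<bar> \<le> d"
      using that abs_Re_le_cmod[of "s - z"] by (simp add: dist_norm)
    then show ?thesis by (simp add: d_def field_simps abs_if split: if_splits)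
  qed
  have "compact ((\<lambda>z. (z - 1) * z * (z + 1)) ` cball s d)"
    by (intro compact_continuous_image continuous_intros) auto
  then obtain C where C: "\<And>z. z \<in> cball s d \<Longrightarrow> norm ((z - 1) * z * (z + 1)) \<le> C"
    using compact_imp_bounded bounded_iff by (metis (no_types, lifting) imageI)
  have "uniform_limit (cball s d) (\<lambda>N s. \<Sum>n<N. zeta_term (Suc n) s)
             (\<lambda>s. \<Sum>n. zeta_term (Suc n) s) sequentially"
  proof (rule Weierstrass_m_test)
    fix n z assume z: "z \<in> cball s d"
    have "norm (zeta_term (Suc n) z) \<le> norm ((z - 1) * z * (z + 1)) * real (Suc n) powr (- Re z - 2)"
      using Re[OF z] d by (intro norm_zeta_term_le) auto
    also have "\<dots> \<le> C * real (Suc n) powr (- 1 - d)"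
      using Re[OF z] C[OF z] order_trans[OF norm_ge_zero C[OF z]] by (intro mult_mono powr_mono) auto
    finally show "norm (zeta_term (Suc n) z) \<le> C * real (Suc n) powr (- 1 - d)" .
  next
    have "summable (\<lambda>n. real n powr (- 1 - d))"
      using d by (subst summable_real_powr_iff) auto
    then show "summable (\<lambda>n. C * real (Suc n) powr (- 1 - d))"
      by (intro summable_mult) (subst summable_Suc_iff)
  qed
  moreover have "cball s d \<subseteq> {s. Re s > - 1}" using Re d by force
  ultimately show ?thesis using d by blast
qed

lemma zeta_term_holomorphic: "zeta_term (Suc n) holomorphic_on A"
  unfolding zeta_term_def by (intro holomorphic_intros) auto

lemma zeta_reg_holomorphic: "zeta_reg holomorphic_on {s. Re s > - 1}"
proof -
  have "(\<lambda>s. \<Sum>n. zeta_term (Suc n) s) holomorphic_on {s. Re s > - 1}"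
    by (rule holomorphic_uniform_sequence[OF open_halfspace_Re_gt, where f = "\<lambda>N s. \<Sum>n<N. zeta_term (Suc n) s"])
       (use zeta_term_uniform_limit in \<open>auto intro!: holomorphic_intros zeta_term_holomorphic\<close>)
  then show ?thesis
    unfolding zeta_reg_def by (intro holomorphic_intros) auto
qed

lemma zeta_term_sums:
  assumes "Re s > - 1"
  shows "(\<lambda>n. zeta_term (Suc n) s) sums (zeta_reg s - (s + 1) / 2)"
proof -
  obtain d where "d > 0" "uniform_limit (cball s d) (\<lambda>N s. \<Sum>n<N. zeta_term (Suc n) s)
             (\<lambda>s. \<Sum>n. zeta_term (Suc n) s) sequentially"
    using zeta_term_uniform_limit[OF assms] by blast
  from tendsto_uniform_limitI[OF this(2), of s] this(1)
  show ?thesis by (simp add: sums_def zeta_reg_def)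
qed

text \<open>Every \<open>zeta_term\<close> vanishes at 1. The value is the residue of zeta at its
  pole.\<close>

lemma zeta_reg_1: "zeta_reg 1 = 1"
  by (simp add: zeta_reg_def zeta_term_def del: of_nat_Suc)

lemma summable_norm_powr_nat:
  assumes "Re s > 1"
  shows "summable (\<lambda>n. norm (of_nat (Suc n) powr (- s) :: complex))"
proof -
  have "summable (\<lambda>n. real n powr (- Re s))"
    using assms by (subst summable_real_powr_iff) auto
  then have "summable (\<lambda>n. real (Suc n) powr (- Re s))"
    by (subst summable_Suc_iff)
  moreover have "norm (of_nat (Suc n) powr (- s) :: complex) = real (Suc n) powr (- Re s)" for n
    using norm_powr_real_powr[of "of_nat (Suc n)" "- s"] by (simp del: of_nat_Suc)
  ultimately show ?thesis by (simp del: of_nat_Suc)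
qed

lemma powr_nat_tendsto_0:
  assumes "Re s < 0"
  shows "(\<lambda>n. of_nat (Suc n) powr s :: complex) \<longlonglongrightarrow> 0"
proof -
  have "(\<lambda>n. real (Suc n) powr Re s) \<longlonglongrightarrow> 0"
    using assms by (intro tendsto_neg_powr LIMSEQ_Suc filterlim_real_sequentially[THEN filterlim_compose] filterlim_Suc) auto
  moreover have "norm (of_nat (Suc n) powr s :: complex) = real (Suc n) powr Re s" for n
    using norm_powr_real_powr[of "of_nat (Suc n)" s] by (simp del: of_nat_Suc)
  ultimately show ?thesis
    by (subst tendsto_norm_zero_iff[symmetric]) (simp del: of_nat_Suc)
qed

lemma zeta_reg_eq_Dirichlet:
  assumes "Re s > 1"
  shows "zeta_reg s = (s - 1) * (\<Sum>n. of_nat (Suc n) powr (- s))"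
proof -
  let ?D = "\<Sum>n. of_nat (Suc n) powr (- s) :: complex"
  have D: "(\<lambda>N. \<Sum>n<N. of_nat (Suc n) powr (- s)) \<longlonglongrightarrow> ?D"
    using summable_LIMSEQ[OF summable_norm_cancel[OF summable_norm_powr_nat[OF assms]]] .
  \<comment> \<open>Neighbouring trapezoids share an endpoint, so inner terms get full weight and
    only the first and the last are halved; the powers with exponent \<open>1 - s\<close>
    telescope.\<close>
  have *: "(\<Sum>n<N. zeta_term (Suc n) s) =
          (s - 1) * ((\<Sum>n<Suc N. of_nat (Suc n) powr (- s)) - 1 / 2 - of_nat (Suc N) powr (- s) / 2)
          + of_nat (Suc N) powr (1 - s) - 1" for N
  proof (induction N)
    case (Suc N)
    show ?case
      unfolding sum.lessThan_Suc[of _ N] Suc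
      by (simp add: zeta_term_def field_simps del: of_nat_Suc)
  qed (simp add: zeta_term_def)
  have "(\<lambda>N. \<Sum>n<N. zeta_term (Suc n) s) \<longlonglongrightarrow> (s - 1) * (?D - 1 / 2 - 0 / 2) + 0 - 1"
    unfolding * by (intro tendsto_intros LIMSEQ_Suc[OF D] powr_nat_tendsto_0) (use assms in auto)
  moreover have "(\<lambda>N. \<Sum>n<N. zeta_term (Suc n) s) \<longlonglongrightarrow> zeta_reg s - (s + 1) / 2"
    using zeta_term_sums[of s] assms by (simp add: sums_def)
  ultimately have "(s - 1) * (?D - 1 / 2 - 0 / 2) + 0 - 1 = zeta_reg s - (s + 1) / 2"
    using LIMSEQ_unique by blast
  then have "zeta_reg s = (s - 1) * (?D - 1 / 2 - 0 / 2) + 0 - 1 + (s + 1) / 2"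
    by (simp only: eq_diff_eq)
  also have "\<dots> = (s - 1) * ?D"
    by (simp add: field_simps del: of_nat_Suc)
  finally show ?thesis .
qed


section \<open>Absence of zeros on and to the right of the line Re s = 1\<close>

definition rough :: "nat \<Rightarrow> nat set" where
  "rough N = {n. n > 0 \<and> (\<forall>p. prime p \<longrightarrow> p \<le> N \<longrightarrow> \<not> p dvd n)}"

lemma rough_0: "rough 0 = {0<..}"
proof -
  have "\<not> p \<le> 0" if "prime p" for p :: nat
    using prime_gt_0_nat[OF that] by simp
  then show ?thesis unfolding rough_def by blast
qed

text \<open>One step of the sieve: cancelling one factor \<open>Suc N\<close> from a number of
  \<open>rough N\<close> leaves a number of \<open>rough N\<close>, and multiplying by the prime
  \<open>Suc N\<close> introduces no smaller prime factor.\<close>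

lemma rough_Suc_prime:
  assumes p: "prime (Suc N)"
  shows "rough N = rough (Suc N) \<union> (\<lambda>n. Suc N * n) ` rough N"
    and "rough (Suc N) \<inter> (\<lambda>n. Suc N * n) ` rough N = {}"
proof -
  have "n \<in> (\<lambda>n. Suc N * n) ` rough N" if "n \<in> rough N" "n \<notin> rough (Suc N)" for n
  proof -
    have "Suc N dvd n" using that by (auto simp: rough_def le_Suc_eq)
    then obtain k where k: "n = Suc N * k" by (elim dvdE)
    then have "k \<in> rough N" using that(1) by (auto simp: rough_def)
    with k show ?thesis by blast
  qed
  moreover have "Suc N * n \<in> rough N" if "n \<in> rough N" for n
  proof -
    have "\<not> q dvd Suc N * n" if q: "prime q" "q \<le> N" for q
    proof
      assume "q dvd Suc N * n"
      then have "q dvd Suc N \<or> q dvd n" using q by (simp only: prime_dvd_mult_iff)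
      then show False
      proof
        assume "q dvd Suc N"
        then have "q = Suc N" using p q by (simp add: primes_dvd_imp_eq)
        then show False using q by simp
      qed (use q \<open>n \<in> rough N\<close> in \<open>auto simp: rough_def\<close>)
    qed
    then show ?thesis using that by (auto simp: rough_def)
  qed
  moreover have "rough (Suc N) \<subseteq> rough N" by (auto simp: rough_def)
  ultimately show "rough N = rough (Suc N) \<union> (\<lambda>n. Suc N * n) ` rough N" by blast
  show "rough (Suc N) \<inter> (\<lambda>n. Suc N * n) ` rough N = {}"
  proof -
    have "Suc N * n \<notin> rough (Suc N)" for n
      using p dvd_triv_left[of "Suc N" n] unfolding rough_def by blast
    then show ?thesis by blast
  qed
qed

lemma rough_Suc_not_prime:
  assumes "\<not> prime (Suc N)"
  shows "rough (Suc N) = rough N"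
proof -
  have "prime p \<and> p \<le> Suc N \<longleftrightarrow> prime p \<and> p \<le> N" for p
    using assms by (cases "p = Suc N") auto
  then show ?thesis unfolding rough_def by blast
qed

lemma summable_on_powr_nat:
  assumes "Re s > 1"
  shows "(\<lambda>n. norm (of_nat n powr (- s) :: complex)) summable_on A"
proof -
  have "summable (\<lambda>n. norm (of_nat n powr (- s) :: complex))"
    by (subst summable_Suc_iff[symmetric]) (rule summable_norm_powr_nat[OF assms])
  then have "(\<lambda>n. norm (of_nat n powr (- s) :: complex)) summable_on UNIV"
    by (subst summable_on_UNIV_nonneg_real_iff) auto
  then show ?thesis using summable_on_subset_banach by blast
qed

lemma powr_nat_mult:
  "of_nat (m * n) powr s = (of_nat m powr s * of_nat n powr s :: complex)"
  unfolding of_nat_mult by (rule powr_times_real) auto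

text \<open>Since the terms are completely multiplicative, multiplying the remaining sum by
  \<open>1 - p powr (- s)\<close> deletes exactly the multiples of the prime
  \<open>p\<close>.\<close>

lemma sieve:
  assumes "Re s > 1"
  shows "(\<Prod>p\<in>{p. prime p \<and> p \<le> N}. 1 - of_nat p powr (- s)) * (\<Sum>\<^sub>\<infinity>n\<in>rough 0. of_nat n powr (- s))
           = (\<Sum>\<^sub>\<infinity>n\<in>rough N. of_nat n powr (- s) :: complex)"
proof (induction N)
  case 0
  have "{p::nat. prime p \<and> p \<le> 0} = {}" by auto
  then show ?case by simp
next
  case (Suc N)
  let ?f = "\<lambda>n. of_nat n powr (- s) :: complex"
  have sm: "?f summable_on A" for A
    by (rule Infinite_Sum.abs_summable_summable[OF summable_on_powr_nat[OF assms]])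
  show ?case
  proof (cases "prime (Suc N)")
    case True
    have "infsum ?f (rough N) = infsum ?f (rough (Suc N)) + infsum ?f ((\<lambda>n. Suc N * n) ` rough N)"
      by (subst rough_Suc_prime(1)[OF True])
         (intro infsum_Un_disjoint sm rough_Suc_prime(2)[OF True])
    also have "infsum ?f ((\<lambda>n. Suc N * n) ` rough N) = infsum (\<lambda>n. ?f (Suc N * n)) (rough N)"
      by (subst infsum_reindex) (auto simp: inj_on_def o_def simp del: mult_Suc)
    also have "\<dots> = ?f (Suc N) * infsum ?f (rough N)"
      unfolding powr_nat_mult by (rule infsum_cmult_right')
    finally have "infsum ?f (rough (Suc N)) = (1 - ?f (Suc N)) * infsum ?f (rough N)"
      by (simp add: algebra_simps)
    moreover have "{p. prime p \<and> p \<le> Suc N} = insert (Suc N) {p. prime p \<and> p \<le> N}"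
      using True by (auto simp: le_Suc_eq)
    ultimately show ?thesis
      using Suc by (simp del: of_nat_Suc)
  next
    case False
    then have "{p. prime p \<and> p \<le> Suc N} = {p. prime p \<and> p \<le> N}"
      by (auto simp: le_Suc_eq)
    then show ?thesis using Suc rough_Suc_not_prime[OF False] by simp
  qed
qed

text \<open>A member of \<open>rough N\<close> other than 1 has a prime factor above
  \<open>N\<close> and so exceeds \<open>N\<close> itself. What is left beside the term 1 is thus
  bounded by a tail of an absolutely convergent series.\<close>

lemma infsum_rough_tendsto:
  assumes "Re s > 1"
  shows "(\<lambda>N. \<Sum>\<^sub>\<infinity>n\<in>rough N. of_nat n powr (- s) :: complex) \<longlonglongrightarrow> 1"
proof -
  let ?f = "\<lambda>n. of_nat n powr (- s) :: complex"
  have sm: "(\<lambda>n. norm (?f n)) summable_on A" for A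
    using summable_on_powr_nat[OF assms] .
  have smN: "summable (\<lambda>n. norm (?f n))"
    by (subst summable_Suc_iff[symmetric]) (rule summable_norm_powr_nat[OF assms])
  have "norm (infsum ?f (rough N) - 1) \<le> (\<Sum>n. norm (?f (n + Suc N)))" for N
  proof -
    have 1: "1 \<in> rough N" by (auto simp: rough_def)
    have "infsum ?f (rough N) = infsum ?f {1} + infsum ?f (rough N - {1})"
      using infsum_Un_disjoint[of ?f "{1}" "rough N - {1}"] 1 Infinite_Sum.abs_summable_summable[OF sm]
      by (simp add: insert_absorb)
    then have "infsum ?f (rough N) - 1 = infsum ?f (rough N - {1})" by simp
    then have "norm (infsum ?f (rough N) - 1) \<le> infsum (\<lambda>n. norm (?f n)) (rough N - {1})"
      using norm_infsum_bound[OF sm] by simp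
    also have "\<dots> \<le> infsum (\<lambda>n. norm (?f n)) ((\<lambda>n. n + Suc N) ` UNIV)"
    proof (rule infsum_mono2)
      show "rough N - {1} \<subseteq> range (\<lambda>n. n + Suc N)"
      proof
        fix n assume n: "n \<in> rough N - {1}"
        then obtain p where "prime p" "p dvd n" using prime_factor_nat[of n] by auto
        then have "\<not> p \<le> N" "p \<le> n" using n by (auto simp: rough_def dvd_imp_le)
        then have "n = (n - Suc N) + Suc N" by simp
        then show "n \<in> range (\<lambda>n. n + Suc N)" by blast
      qed
    qed (use sm in auto)
    also have "\<dots> = infsum (\<lambda>n. norm (?f (n + Suc N))) UNIV"
      by (subst infsum_reindex) (auto simp: o_def inj_on_def)
    also have "\<dots> = (\<Sum>n. norm (?f (n + Suc N)))"
    proof (rule infsumI, rule norm_summable_imp_has_sum)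
      have "summable (\<lambda>n. norm (?f (n + Suc N)))"
        using summable_ignore_initial_segment[OF smN] .
      then show "summable (\<lambda>n. norm (norm (?f (n + Suc N))))"
        "(\<lambda>n. norm (?f (n + Suc N))) sums (\<Sum>n. norm (?f (n + Suc N)))" by (auto intro: summable_sums)
    qed
    finally show ?thesis .
  qed
  moreover have "(\<lambda>N. \<Sum>n. norm (?f (n + Suc N))) \<longlonglongrightarrow> 0"
    using LIMSEQ_Suc[OF suminf_exist_split2[OF smN]] by simp
  ultimately have "(\<lambda>N. infsum ?f (rough N) - 1) \<longlonglongrightarrow> 0"
    by (rule Lim_null_comparison[OF always_eventually[OF allI]])
  then show ?thesis by (simp only: LIM_zero_iff)
qed

lemma infsum_rough_0:
  assumes "Re s > 1"
  shows "(\<Sum>\<^sub>\<infinity>n\<in>rough 0. of_nat n powr (- s) :: complex) = (\<Sum>n. of_nat (Suc n) powr (- s))"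
proof -
  have "rough 0 = range Suc"
    unfolding rough_0 by (rule greaterThan_0)
  then have "(\<Sum>\<^sub>\<infinity>n\<in>rough 0. of_nat n powr (- s) :: complex) = (\<Sum>\<^sub>\<infinity>n. of_nat (Suc n) powr (- s))"
    by (simp add: infsum_reindex o_def del: of_nat_Suc)
  also have "\<dots> = (\<Sum>n. of_nat (Suc n) powr (- s))"
    using summable_norm_powr_nat[OF assms]
    by (intro infsumI norm_summable_imp_has_sum summable_sums) (auto dest: summable_norm_cancel)
  finally show ?thesis .
qed

section \<open>Euler product and the 3-4-1 inequality\<close>

text \<open>The logarithm of the norm is minus the sum of \<open>r ^ n / n\<close> times
  \<open>3 + 4 * Re (z ^ n) + Re (z ^ (2 * n))\<close>. By the double angle formula the latter
  equals \<open>2 * (1 + Re (z ^ n))\<^sup>2\<close>, which is nonnegative.\<close>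

lemma norm_mertens_le_1:
  fixes r :: real and z :: complex
  assumes "0 < r" "r < 1" "norm z = 1"
  shows "norm ((1 - of_real r) ^ 3 * (1 - of_real r * z) ^ 4 * (1 - of_real r * z\<^sup>2)) \<le> 1"
proof -
  \<comment> \<open>The real part of the series of the complex logarithm. Its term at
    \<open>n = 0\<close> is 0, because division by 0 yields 0.\<close>
  have ser: "(\<lambda>n. - (r ^ n / n) * Re (w ^ n)) sums ln (norm (1 - of_real r * w))"
    if "norm w = 1" for w :: complex
  proof -
    have n: "norm (of_real r * w) < 1" using assms that by (simp add: norm_mult)
    then have nz: "1 - of_real r * w \<noteq> 0" by auto
    have "(\<lambda>n. - ((of_real r * w) ^ n) / of_nat n) sums ln (1 + (- of_real r * w))"
      using Ln_series'[of "- of_real r * w"] n by simp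
    from sums_Re[OF this]
    have "(\<lambda>n. Re (- ((of_real r * w) ^ n) / of_nat n)) sums ln (norm (1 - of_real r * w))"
      using nz by simp
    moreover have "Re (- ((of_real r * w) ^ n) / of_nat n) = - (r ^ n / n) * Re (w ^ n)" for n
    proof -
      have "- ((of_real r * w) ^ n) / of_nat n = of_real (- (r ^ n / n)) * w ^ n"
        by (simp add: power_mult_distrib)
      moreover have "Re (of_real a * v) = a * Re v" for a :: real and v :: complex
        by simp
      ultimately show ?thesis by (simp only:)
    qed
    ultimately show ?thesis by (simp only:)
  qed
  have s: "(\<lambda>n. 3 * (- (r ^ n / n) * Re (1 ^ n)) + 4 * (- (r ^ n / n) * Re (z ^ n)) + - (r ^ n / n) * Re ((z\<^sup>2) ^ n))
     sums (3 * ln (norm (1 - of_real r * 1 :: complex)) + 4 * ln (norm (1 - of_real r * z)) + ln (norm (1 - of_real r * z\<^sup>2)))"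
    using assms by (intro sums_add sums_mult ser) (auto simp: norm_power)
  have "3 * ln (norm (1 - of_real r * 1 :: complex)) + 4 * ln (norm (1 - of_real r * z)) + ln (norm (1 - of_real r * z\<^sup>2)) \<le> 0"
  proof (rule sums_le[OF _ s sums_zero])
    fix n
    define w where "w = z ^ n"
    have "norm w = 1" using assms by (simp add: w_def norm_power)
    then have w: "Re w ^ 2 + Im w ^ 2 = 1" by (simp add: cmod_def)
    have "(z\<^sup>2) ^ n = w ^ 2" by (simp add: w_def power_mult[symmetric] mult.commute)
    then have "Re ((z\<^sup>2) ^ n) = 2 * Re w ^ 2 - 1" using w by (simp add: power2_eq_square)
    then have "3 + 4 * Re w + Re ((z\<^sup>2) ^ n) = 2 * (1 + Re w) ^ 2" by (simp add: power2_eq_square algebra_simps)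
    then have "0 \<le> 3 + 4 * Re w + Re ((z\<^sup>2) ^ n)" by simp
    then have "0 \<le> (r ^ n / n) * (3 + 4 * Re w + Re ((z\<^sup>2) ^ n))" using assms by (intro mult_nonneg_nonneg) auto
    then show "3 * (- (r ^ n / n) * Re (1 ^ n)) + 4 * (- (r ^ n / n) * Re (z ^ n)) + - (r ^ n / n) * Re ((z\<^sup>2) ^ n) \<le> 0"
      by (simp add: w_def algebra_simps)
  qed
  moreover have nz: "1 - of_real r * w \<noteq> 0" if "norm w = 1" for w :: complex
  proof
    assume "1 - of_real r * w = 0"
    then have "norm (of_real r * w) = 1" by simp
    then show False using that assms by (simp add: norm_mult)
  qed
  ultimately have "ln (norm ((1 - of_real r) ^ 3 * (1 - of_real r * z) ^ 4 * (1 - of_real r * z\<^sup>2))) \<le> 0"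
    using nz[of 1] nz[of z] nz[of "z\<^sup>2"] assms
    by (simp add: norm_mult norm_power ln_mult ln_realpow)
  then show ?thesis
    using nz[of 1] nz[of z] nz[of "z\<^sup>2"] assms by (subst (asm) ln_le_zero_iff) (auto simp: norm_power)
qed

text \<open>Keeping the Dirichlet series inside the limit avoids any inverse: a zero of the series
  would turn the limit 1 into 0.\<close>

lemma Euler_product:
  assumes "Re s > 1"
  shows "(\<lambda>N. (\<Prod>p\<in>{p. prime p \<and> p \<le> N}. 1 - of_nat p powr (- s)) * (\<Sum>n. of_nat (Suc n) powr (- s) :: complex))
           \<longlonglongrightarrow> 1"
proof -
  have *: "(\<Prod>p\<in>{p. prime p \<and> p \<le> N}. 1 - of_nat p powr (- s)) * (\<Sum>n. of_nat (Suc n) powr (- s) :: complex)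
         = (\<Sum>\<^sub>\<infinity>n\<in>rough N. of_nat n powr (- s))" for N
    using sieve[OF assms, of N] infsum_rough_0[OF assms] by (rule back_subst)
  show ?thesis
    unfolding * using infsum_rough_tendsto[OF assms] .
qed

lemma norm_Euler_factor_mertens_le_1:
  fixes p :: nat and x t :: real
  assumes "p > 1" "x > 1"
  shows "norm ((1 - of_nat p powr (- of_real x)) ^ 3 * (1 - of_nat p powr (- Complex x t)) ^ 4 *
           (1 - of_nat p powr (- Complex x (2 * t))) :: complex) \<le> 1"
proof -
  \<comment> \<open>Here \<open>p powr (- Complex x t)\<close> is \<open>r * z\<close> with
    \<open>r = p powr (- x)\<close> and \<open>z\<close> on the unit circle; doubling
    \<open>t\<close> squares \<open>z\<close>.\<close>
  define z :: complex where "z = of_nat p powr (- \<i> * t)"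
  have "norm z = real p powr Re (- \<i> * t)"
    unfolding z_def by (subst norm_powr_real_powr) auto
  then have z: "norm z = 1" using assms by simp
  have x: "(of_nat p powr (- of_real x) :: complex) = of_real (real p powr (- x))"
    using powr_of_real[of "real p" "- x"] by simp
  have e: "Complex x t = of_real x + \<i> * t" "Complex x (2 * t) = of_real x + \<i> * t + \<i> * t"
    by (simp_all add: complex_eq_iff)
  have x1: "of_nat p powr (- Complex x t) = of_real (real p powr (- x)) * z"
    unfolding x[symmetric] z_def e powr_add[symmetric] by simp
  have x2: "of_nat p powr (- Complex x (2 * t)) = of_real (real p powr (- x)) * z\<^sup>2"
    unfolding x[symmetric] z_def e power2_eq_square powr_add[symmetric] by (simp add: algebra_simps)
  have "real p powr (- x) < 1" using assms by (simp add: powr_less_one)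
  then show ?thesis
    unfolding x x1 x2 using z assms by (intro norm_mertens_le_1) auto
qed

text \<open>The same combination of finite Euler products has norm at most 1, prime by prime, yet
  its product with \<open>?D\<close> tends to 1.\<close>

lemma norm_Dirichlet_mertens_ge_1:
  assumes "x > 1"
  defines "D \<equiv> \<lambda>s. (\<Sum>n. of_nat (Suc n) powr (- s) :: complex)"
  shows "norm (D (of_real x) ^ 3 * D (Complex x t) ^ 4 * D (Complex x (2 * t))) \<ge> 1"
proof -
  define P where "P = (\<lambda>N s. \<Prod>p\<in>{p. prime p \<and> p \<le> N}. 1 - of_nat p powr (- s) :: complex)"
  let ?D = "D (of_real x) ^ 3 * D (Complex x t) ^ 4 * D (Complex x (2 * t))"
  let ?P = "\<lambda>N. P N (of_real x) ^ 3 * P N (Complex x t) ^ 4 * P N (Complex x (2 * t))"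
  have "(\<lambda>N. (P N (of_real x) * D (of_real x)) ^ 3 * (P N (Complex x t) * D (Complex x t)) ^ 4
           * (P N (Complex x (2 * t)) * D (Complex x (2 * t)))) \<longlonglongrightarrow> 1 ^ 3 * 1 ^ 4 * 1"
    unfolding P_def D_def using assms by (intro tendsto_intros Euler_product) auto
  then have lim: "(\<lambda>N. norm (?P N * ?D)) \<longlonglongrightarrow> norm (1::complex)"
    by (intro tendsto_norm) (simp add: power_mult_distrib mult_ac)
  have "norm (?P N) \<le> 1" for N
  proof -
    have "?P N = (\<Prod>p\<in>{p. prime p \<and> p \<le> N}. (1 - of_nat p powr (- of_real x)) ^ 3 *
              (1 - of_nat p powr (- Complex x t)) ^ 4 * (1 - of_nat p powr (- Complex x (2 * t))))"
      by (simp only: P_def prod.distrib prod_power_distrib)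
    then have "norm (?P N) = (\<Prod>p\<in>{p. prime p \<and> p \<le> N}. norm ((1 - of_nat p powr (- of_real x)) ^ 3 *
              (1 - of_nat p powr (- Complex x t)) ^ 4 * (1 - of_nat p powr (- Complex x (2 * t))) :: complex))"
      by (simp only: prod_norm)
    also have "\<dots> \<le> 1"
      using norm_Euler_factor_mertens_le_1[OF prime_gt_1_nat assms(1)]
      by (intro prod_le_1 conjI norm_ge_zero) blast
    finally show ?thesis .
  qed
  then have "\<forall>N\<ge>0. norm (?P N * ?D) \<le> norm ?D"
    by (intro allI impI, subst norm_mult, intro mult_left_le_one_le norm_ge_zero)
  then have "norm (1::complex) \<le> norm ?D"
    by (intro LIMSEQ_le_const2[OF lim] exI)
  then show ?thesis by simp
qed

lemma zeta_reg_nonzero_Re_gt_1: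
  assumes "Re s > 1"
  shows "zeta_reg s \<noteq> 0"
proof
  assume "zeta_reg s = 0"
  then have "(\<Sum>n. of_nat (Suc n) powr (- s) :: complex) = 0"
    using assms zeta_reg_eq_Dirichlet[OF assms] by auto
  with Euler_product[OF assms] have "(\<lambda>_. 0 :: complex) \<longlonglongrightarrow> 1" by simp
  then show False by (simp add: LIMSEQ_const_iff)
qed

text \<open>Suppose zeta vanishes at \<open>Complex 1 t\<close>. As \<open>x\<close> decreases to 1,
  the third power of the simple pole at 1 is outweighed by the fourth power of this zero, while the
  value at \<open>Complex x (2 * t)\<close> stays bounded. The Mertens product then tends to 0,
  although its norm is at least 1.\<close>

lemma zeta_reg_nonzero_Re_eq_1:
  assumes "Re s = 1"
  shows "zeta_reg s \<noteq> 0"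
proof
  assume z: "zeta_reg s = 0"
  define t where "t = Im s"
  have s: "s = Complex 1 t" using assms by (simp add: t_def complex_eq_iff)
  \<comment> \<open>At \<open>t = 0\<close> the point would be 1, where \<open>zeta_reg\<close> is
    1. For nonzero \<open>t\<close> the denominators \<open>?s2 x - 1\<close> and
    \<open>?s3 x - 1\<close> have nonzero limits.\<close>
  have t: "t \<noteq> 0" using z zeta_reg_1 unfolding s by (auto simp: complex_eq_iff one_complex.ctr)
  let ?s1 = "\<lambda>x. of_real x :: complex" and ?s2 = "\<lambda>x. Complex x t" and ?s3 = "\<lambda>x. Complex x (2 * t)"
  have diff: "zeta_reg field_differentiable at w" if "Re w > -1" for w
    using zeta_reg_holomorphic that open_halfspace_Re_gt holomorphic_on_imp_differentiable_at by blast
  obtain d where "(zeta_reg has_field_derivative d) (at s)"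
    using diff[of s] assms by (auto simp: field_differentiable_def)
  then have "((\<lambda>w. (zeta_reg w - zeta_reg s) / (w - s)) \<longlongrightarrow> d) (at s)"
    by (simp add: has_field_derivative_iff)
  moreover have "filterlim ?s2 (at s) (at_right 1)"
  proof (rule filterlim_atI)
    have "((\<lambda>x. of_real x + \<i> * t :: complex) \<longlongrightarrow> of_real 1 + \<i> * t) (at_right 1)"
      by (intro tendsto_intros)
    then show "(?s2 \<longlongrightarrow> s) (at_right 1)" by (simp add: s Complex_eq)
  qed (auto simp: s eventually_at_filter)
  ultimately have q: "((\<lambda>x. (zeta_reg (?s2 x) - zeta_reg s) / (?s2 x - s)) \<longlongrightarrow> d) (at_right 1)"
    by (rule filterlim_compose)
  have e: "?s2 x - s = of_real (x - 1)" for x by (simp add: s complex_eq_iff)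
  have lim: "((\<lambda>x. zeta_reg (Complex x u)) \<longlongrightarrow> zeta_reg (Complex 1 u)) (at_right 1)" for u
  proof -
    have "((\<lambda>x. of_real x + \<i> * u :: complex) \<longlongrightarrow> of_real 1 + \<i> * u) (at_right 1)"
      by (intro tendsto_intros)
    then have "((\<lambda>x. Complex x u) \<longlongrightarrow> Complex 1 u) (at_right 1)" by (simp add: Complex_eq)
    moreover have "isCont zeta_reg (Complex 1 u)"
      using diff[of "Complex 1 u"] by (simp add: field_differentiable_imp_continuous_at)
    ultimately show ?thesis using isCont_tendsto_compose by blast
  qed
  \<comment> \<open>The norm of the Mertens product in terms of \<open>zeta_reg\<close>: the pole
    contributes \<open>(x - 1)\<close> to the power -3, and pulling out a difference quotient at the
    zero contributes the power 4, which leaves one factor \<open>x - 1\<close>.\<close>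
  let ?B = "\<lambda>x. (x - 1) * norm (zeta_reg (Complex x 0) ^ 3
             * ((zeta_reg (?s2 x) - zeta_reg s) / (?s2 x - s) / (?s2 x - 1)) ^ 4
             * (zeta_reg (?s3 x) / (?s3 x - 1)))"
  have "((\<lambda>x. ?s3 x - 1) \<longlongrightarrow> ?s3 1 - 1) (at_right 1)" "((\<lambda>x. ?s2 x - 1) \<longlongrightarrow> ?s2 1 - 1) (at_right 1)"
    unfolding Complex_eq by (intro tendsto_intros)+
  then have "(?B \<longlongrightarrow> (1 - 1) * norm (zeta_reg (Complex 1 0) ^ 3 * (d / (?s2 1 - 1)) ^ 4
               * (zeta_reg (?s3 1) / (?s3 1 - 1)))) (at_right 1)"
    using t by (intro tendsto_intros lim q) (auto simp: complex_eq_iff)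
  then have "(?B \<longlongrightarrow> 0) (at_right 1)" by simp
  then have "eventually (\<lambda>x. ?B x < 1) (at_right 1)"
    by (rule order_tendstoD) simp
  moreover have "eventually (\<lambda>x. x > 1) (at_right (1::real))"
    by (simp add: eventually_at_filter)
  ultimately have "eventually (\<lambda>x. ?B x < 1 \<and> x > 1) (at_right 1)"
    by eventually_elim simp
  then obtain x where x: "?B x < 1" "x > 1"
    using eventually_happens trivial_limit_at_right_real by blast
  define D where "D = (\<lambda>s. (\<Sum>n. of_nat (Suc n) powr (- s) :: complex))"
  have D: "zeta_reg s = (s - 1) * D s" if "Re s > 1" for s
    using zeta_reg_eq_Dirichlet[OF that] by (simp add: D_def)
  define \<epsilon> where "\<epsilon> = complex_of_real (x - 1)"
  define q where "q = (zeta_reg (?s2 x) - zeta_reg s) / (?s2 x - s)"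
  have \<epsilon>: "\<epsilon> \<noteq> 0" using x(2) by (simp add: \<epsilon>_def)
  have w: "?s2 x - 1 \<noteq> 0" "?s3 x - 1 \<noteq> 0"
    using x(2) by (auto simp: complex_eq_iff)
  have D1: "D (of_real x) = zeta_reg (Complex x 0) / \<epsilon>"
    using D[of "of_real x"] x(2) \<epsilon> unfolding complex_of_real_def[of x, symmetric] \<epsilon>_def by simp
  have "zeta_reg (?s2 x) = q * \<epsilon>"
    using \<epsilon> unfolding q_def e \<epsilon>_def[symmetric] z by simp
  then have D2: "D (?s2 x) = q * \<epsilon> / (?s2 x - 1)"
    using D[of "?s2 x"] x(2) w by (simp add: eq_divide_eq mult.commute)
  have D3: "D (?s3 x) = zeta_reg (?s3 x) / (?s3 x - 1)"
    using D[of "?s3 x"] x(2) w by (simp add: eq_divide_eq mult.commute)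
  have "(a / \<epsilon>) ^ 3 * (q * \<epsilon> / b) ^ 4 * c = \<epsilon> * (a ^ 3 * (q / b) ^ 4 * c)" for a b c
    using \<epsilon> by (simp add: eval_nat_numeral)
  then have "D (of_real x) ^ 3 * D (?s2 x) ^ 4 * D (?s3 x) =
      \<epsilon> * (zeta_reg (Complex x 0) ^ 3 * (q / (?s2 x - 1)) ^ 4 * (zeta_reg (?s3 x) / (?s3 x - 1)))"
    unfolding D1 D2 D3 .
  then have eq: "norm (D (of_real x) ^ 3 * D (?s2 x) ^ 4 * D (?s3 x)) = ?B x"
    using x(2) unfolding q_def by (simp only: norm_mult) (simp add: \<epsilon>_def del: of_real_diff)
  have "1 \<le> norm (D (of_real x) ^ 3 * D (?s2 x) ^ 4 * D (?s3 x))"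
    using norm_Dirichlet_mertens_ge_1[OF x(2), of t] by (simp only: D_def)
  then have "1 \<le> ?B x" by (simp only: eq)
  with x(1) show False by linarith
qed


section \<open>The functional equation\<close>

text \<open>Euler's integral rescaled by \<open>t = b * x\<close>. Integrals are taken in
  \<open>ennreal\<close>, where Tonelli's theorem and monotone convergence let nonnegative integrals
  and sums be exchanged.\<close>

lemma nn_integral_exp_powr:
  assumes "a > 0" "b > (0::real)"
  shows "(\<integral>\<^sup>+x. ennreal (indicator {0<..} x * (x powr (a - 1) * exp (- (b * x)))) \<partial>lborel)
           = ennreal (Gamma a * b powr (- a))"
proof -
  have "ennreal (Gamma a) = (\<integral>\<^sup>+t. ennreal (indicator {0..} t * t powr (a - 1) / exp t) \<partial>lborel)"
    by (rule Gamma_conv_nn_integral_real[OF assms(1)])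
  also have "\<dots> = ennreal \<bar>b\<bar> * (\<integral>\<^sup>+x. ennreal (indicator {0..} (0 + b * x) * (0 + b * x) powr (a - 1) / exp (0 + b * x)) \<partial>lborel)"
    using assms by (intro nn_integral_real_affine) auto
  also have "\<dots> = (\<integral>\<^sup>+x. ennreal (b powr a) * ennreal (indicator {0<..} x * (x powr (a - 1) * exp (- (b * x)))) \<partial>lborel)"
  proof (subst nn_integral_cmult[symmetric], simp, rule nn_integral_cong_AE, rule eventually_mono[OF AE_lborel_singleton[of 0]])
    fix x :: real assume "x \<noteq> 0"
    then consider "x > 0" | "x < 0" by linarith
    then show "ennreal \<bar>b\<bar> * ennreal (indicator {0..} (0 + b * x) * (0 + b * x) powr (a - 1) / exp (0 + b * x)) =
        ennreal (b powr a) * ennreal (indicator {0<..} x * (x powr (a - 1) * exp (- (b * x))))"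
    proof cases
      case 1
      have "b * (b * x) powr (a - 1) = b powr a * x powr (a - 1)"
        using 1 assms by (simp add: powr_mult powr_diff)
      then show ?thesis using 1 assms
        by (simp add: ennreal_mult'[symmetric] exp_minus field_simps)
    next
      case 2
      then show ?thesis using assms by (simp add: mult_less_0_iff indicator_def not_le zero_le_mult_iff)
    qed
  qed
  also have "\<dots> = ennreal (b powr a) * (\<integral>\<^sup>+x. ennreal (indicator {0<..} x * (x powr (a - 1) * exp (- (b * x)))) \<partial>lborel)"
    by (rule nn_integral_cmult) measurable
  finally have "ennreal (b powr (- a)) * ennreal (Gamma a) = ennreal (b powr (- a)) * (ennreal (b powr a) * (\<integral>\<^sup>+x. ennreal (indicator {0<..} x * (x powr (a - 1) * exp (- (b * x)))) \<partial>lborel))"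
    by simp
  also have "\<dots> = (\<integral>\<^sup>+x. ennreal (indicator {0<..} x * (x powr (a - 1) * exp (- (b * x)))) \<partial>lborel)"
    using assms by (simp add: mult.assoc[symmetric] ennreal_mult'[symmetric] powr_minus)
  finally show ?thesis
    using assms by (simp add: ennreal_mult'[symmetric] mult.commute)
qed

text \<open>Substitution of \<open>t = x\<^sup>2\<close> on the compact intervals
  \<open>{0..real (Suc n)}\<close>, followed by monotone convergence.\<close>

lemma nn_integral_square_substitution:
  fixes f :: "real \<Rightarrow> real"
  assumes f [measurable]: "f \<in> borel_measurable borel"
  shows "(\<integral>\<^sup>+t. ennreal (indicator {0<..} t * f t) \<partial>lborel)
           = (\<integral>\<^sup>+x. ennreal (indicator {0<..} x * (f (x\<^sup>2) * (2 * x))) \<partial>lborel)"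
proof -
  let ?g = "\<lambda>t. ennreal (indicator {0<..} t * f t)"
  let ?h = "\<lambda>x. ennreal (indicator {0<..} x * (f (x\<^sup>2) * (2 * x)))"
  have *: "(\<integral>\<^sup>+t. ?g t * indicator {0..(real (Suc n))\<^sup>2} t \<partial>lborel) = (\<integral>\<^sup>+x. ?h x * indicator {0..real (Suc n)} x \<partial>lborel)" for n
  proof -
    have "(\<integral>\<^sup>+t. ?g t * indicator {0\<^sup>2..(real (Suc n))\<^sup>2} t \<partial>lborel) =
        (\<integral>\<^sup>+x. ?g (x\<^sup>2) * ennreal (2 * x) * indicator {0..real (Suc n)} x \<partial>lborel)"
      by (rule nn_integral_substitution_aux[where g = "\<lambda>x. x\<^sup>2" and g' = "\<lambda>x. 2 * x"])
         (auto intro!: derivative_eq_intros continuous_intros)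
    also have "\<dots> = (\<integral>\<^sup>+x. ?h x * indicator {0..real (Suc n)} x \<partial>lborel)"
      by (intro nn_integral_cong) (auto simp: indicator_def ennreal_mult''[symmetric])
    finally show ?thesis by simp
  qed
  have sup: "(\<integral>\<^sup>+t. u t \<partial>lborel) = (SUP n. \<integral>\<^sup>+t. u t * indicator {0..r n} t \<partial>lborel)"
    if u: "\<And>t. t \<le> 0 \<Longrightarrow> u t = 0" "u \<in> borel_measurable borel" and r: "mono r" "\<And>t. \<exists>n. t \<le> r n"
    for u :: "real \<Rightarrow> ennreal" and r :: "nat \<Rightarrow> real"
  proof -
    have "(SUP n. \<integral>\<^sup>+t. u t * indicator {0..r n} t \<partial>lborel) = (\<integral>\<^sup>+t. (SUP n. u t * indicator {0..r n} t) \<partial>lborel)"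
    proof (rule nn_integral_monotone_convergence_SUP[symmetric])
      show "incseq (\<lambda>n t. u t * indicator {0..r n} t)"
      proof (intro incseq_SucI le_funI mult_left_mono)
        fix n and t :: real
        have "r n \<le> r (Suc n)" using \<open>mono r\<close> by (auto simp: mono_def)
        then show "indicator {0..r n} t \<le> (indicator {0..r (Suc n)} t :: ennreal)"
          by (auto simp: indicator_def)
      qed auto
    qed (use u in auto)
    moreover have "(SUP n. u t * indicator {0..r n} t) = u t" for t
    proof (cases "t \<le> 0")
      case False
      obtain n where n: "t \<le> r n" using r(2) by blast
      show ?thesis
      proof (rule antisym)
        show "u t \<le> (SUP n. u t * indicator {0..r n} t)"
          using n False by (intro SUP_upper2[of n]) auto
      qed (auto intro!: SUP_least simp: indicator_def)
    qed (use u in simp)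
    ultimately show ?thesis by simp
  qed
  have "(\<integral>\<^sup>+t. ?g t \<partial>lborel) = (SUP n. \<integral>\<^sup>+t. ?g t * indicator {0..(real (Suc n))\<^sup>2} t \<partial>lborel)"
  proof (rule sup)
    show "\<exists>n. t \<le> (real (Suc n))\<^sup>2" for t
    proof -
      obtain n where "t \<le> real n" using real_arch_simple by blast
      also have "real n \<le> (real (Suc n))\<^sup>2" by (simp add: power2_eq_square algebra_simps)
      finally show ?thesis by blast
    qed
  qed (auto simp: mono_def)
  also have "\<dots> = (SUP n. \<integral>\<^sup>+x. ?h x * indicator {0..real (Suc n)} x \<partial>lborel)"
    unfolding * ..
  also have "\<dots> = (\<integral>\<^sup>+t. ?h t \<partial>lborel)"
  proof (rule sup[symmetric])
    show "\<exists>n. t \<le> real (Suc n)" for t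
    proof -
      obtain n where "t \<le> real n" using real_arch_simple by blast
      also have "real n \<le> real (Suc n)" by simp
      finally show ?thesis by blast
    qed
  qed (auto simp: mono_def)
  finally show ?thesis .
qed

lemma power2_powr:
  fixes x q :: real
  assumes "x > 0"
  shows "(x\<^sup>2) powr q = x powr (2 * q)"
  using assms by (simp add: powr_powr flip: powr_numeral)

lemma nn_integral_gaussian_powr:
  assumes "s > - 1" "w > (0::real)"
  shows "(\<integral>\<^sup>+x. ennreal (indicator {0<..} x * (x powr s * exp (- (w * x\<^sup>2)))) \<partial>lborel)
           = ennreal (Gamma ((s + 1) / 2) / 2 * w powr (- ((s + 1) / 2)))"
proof -
  let ?a = "(s + 1) / 2"
  have "ennreal (Gamma ?a / 2 * w powr (- ?a)) = ennreal (1 / 2) * ennreal (Gamma ?a * w powr (- ?a))"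
    by (subst ennreal_mult'[symmetric]) auto
  also have "ennreal (Gamma ?a * w powr (- ?a)) =
      (\<integral>\<^sup>+x. ennreal (indicator {0<..} x * (x powr (?a - 1) * exp (- (w * x)))) \<partial>lborel)"
    using assms by (intro nn_integral_exp_powr[symmetric]) auto
  also have "\<dots> = (\<integral>\<^sup>+x. ennreal (indicator {0<..} x * ((x\<^sup>2) powr (?a - 1) * exp (- (w * x\<^sup>2)) * (2 * x))) \<partial>lborel)"
    by (rule nn_integral_square_substitution) measurable
  also have "ennreal (1 / 2) * \<dots> = (\<integral>\<^sup>+x. ennreal (1 / 2) * ennreal (indicator {0<..} x * ((x\<^sup>2) powr (?a - 1) * exp (- (w * x\<^sup>2)) * (2 * x))) \<partial>lborel)"
    by (rule nn_integral_cmult[symmetric]) measurable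
  also have "\<dots> = (\<integral>\<^sup>+x. ennreal (indicator {0<..} x * (x powr s * exp (- (w * x\<^sup>2)))) \<partial>lborel)"
  proof (rule nn_integral_cong)
    fix x :: real
    have "(x\<^sup>2) powr (?a - 1) * x = x powr s" if "x > 0"
    proof -
      have "2 * (?a - 1) = s - 1" by (simp add: diff_divide_distrib add_divide_distrib)
      then have "(x\<^sup>2) powr (?a - 1) = x powr (s - 1)"
        using power2_powr[OF that, of "?a - 1"] by (simp only:)
      then show ?thesis using that by (simp add: powr_diff)
    qed
    then show "ennreal (1 / 2) * ennreal (indicator {0<..} x * ((x\<^sup>2) powr (?a - 1) * exp (- (w * x\<^sup>2)) * (2 * x))) =
         ennreal (indicator {0<..} x * (x powr s * exp (- (w * x\<^sup>2))))"
      by (subst ennreal_mult'[symmetric]) (auto simp: indicator_def mult_ac)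
  qed
  finally show ?thesis ..
qed

lemma Gamma_reflection_real: "Gamma z * Gamma (1 - z) = pi / sin (pi * z)" for z :: real
proof -
  have "complex_of_real (Gamma z * Gamma (1 - z)) = Gamma (of_real z) * Gamma (1 - of_real z)"
    using Gamma_complex_of_real[of z] Gamma_complex_of_real[of "1 - z"] by simp
  also have "\<dots> = of_real pi / sin (of_real pi * of_real z)"
    by (rule Gamma_reflection_complex)
  also have "\<dots> = of_real (pi / sin (pi * z))"
    by (simp add: sin_of_real flip: of_real_mult)
  finally show ?thesis
    by (simp only: of_real_eq_iff)
qed

lemma Gamma_reflection_half:
  fixes s :: real
  shows "Gamma ((s + 1) / 2) * Gamma ((1 - s) / 2) = pi / cos (pi * s / 2)"
proof -
  have "sin (pi * ((s + 1) / 2)) = sin (pi * s / 2 + pi / 2)"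
    by (rule arg_cong[where f = sin]) (simp add: field_simps)
  then have "sin (pi * ((s + 1) / 2)) = cos (pi * s / 2)"
    by (simp add: sin_add)
  moreover have "1 - (s + 1) / 2 = (1 - s) / 2" by (simp add: field_simps)
  ultimately show ?thesis using Gamma_reflection_real[of "(s + 1) / 2"] by (simp only:)
qed

text \<open>The quotient \<open>1 / (x\<^sup>2 + c\<^sup>2)\<close> is the integral of
  \<open>exp (- ((x\<^sup>2 + c\<^sup>2) * w))\<close> over positive \<open>w\<close>. Integrating
  over \<open>x\<close> first and then over \<open>w\<close> gives two Gamma values, whose product
  the reflection formula evaluates.\<close>

lemma nn_integral_powr_over_quadratic:
  assumes s: "- 1 < s" "s < (1::real)" and c: "c > 0"
  shows "(\<integral>\<^sup>+x. ennreal (indicator {0<..} x * (x powr s / (x\<^sup>2 + c\<^sup>2))) \<partial>lborel)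
           = ennreal (pi / (2 * cos (pi * s / 2)) * c powr (s - 1))"
proof -
  let ?f = "\<lambda>x w. ennreal (indicator {0<..} x * x powr s) * ennreal (indicator {0<..} w * exp (- ((x\<^sup>2 + c\<^sup>2) * w)))"
  have 1: "(\<integral>\<^sup>+w. ?f x w \<partial>lborel) = ennreal (indicator {0<..} x * (x powr s / (x\<^sup>2 + c\<^sup>2)))" for x
  proof -
    have p: "x\<^sup>2 + c\<^sup>2 > 0" using c by (simp add: add_nonneg_pos)
    have "(\<integral>\<^sup>+w. ?f x w \<partial>lborel) = ennreal (indicator {0<..} x * x powr s) *
        (\<integral>\<^sup>+w. ennreal (indicator {0<..} w * exp (- ((x\<^sup>2 + c\<^sup>2) * w))) \<partial>lborel)"
      by (rule nn_integral_cmult) measurable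
    also have "(\<integral>\<^sup>+w. ennreal (indicator {0<..} w * exp (- ((x\<^sup>2 + c\<^sup>2) * w))) \<partial>lborel) =
        (\<integral>\<^sup>+w. ennreal (indicator {0<..} w * (w powr (1 - 1) * exp (- ((x\<^sup>2 + c\<^sup>2) * w)))) \<partial>lborel)"
      by (intro nn_integral_cong) (auto simp: indicator_def)
    also have "\<dots> = ennreal (Gamma 1 * (x\<^sup>2 + c\<^sup>2) powr (- 1))"
      using p by (intro nn_integral_exp_powr) auto
    also have "ennreal (indicator {0<..} x * x powr s) * \<dots> = ennreal (indicator {0<..} x * (x powr s / (x\<^sup>2 + c\<^sup>2)))"
      using p by (subst ennreal_mult''[symmetric]) (auto simp: powr_minus divide_inverse mult_ac)
    finally show ?thesis .
  qed
  have 2: "(\<integral>\<^sup>+x. ?f x w \<partial>lborel) = ennreal (Gamma ((s + 1) / 2) / 2) *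
      ennreal (indicator {0<..} w * (w powr ((1 - s) / 2 - 1) * exp (- (c\<^sup>2 * w))))" for w
  proof (cases "w > 0")
    case True
    have "(\<integral>\<^sup>+x. ?f x w \<partial>lborel) =
        (\<integral>\<^sup>+x. ennreal (exp (- (c\<^sup>2 * w))) * ennreal (indicator {0<..} x * (x powr s * exp (- (w * x\<^sup>2)))) \<partial>lborel)"
      using True by (intro nn_integral_cong) (auto simp: indicator_def ennreal_mult''[symmetric] algebra_simps exp_add[symmetric])
    also have "\<dots> = ennreal (exp (- (c\<^sup>2 * w))) * (\<integral>\<^sup>+x. ennreal (indicator {0<..} x * (x powr s * exp (- (w * x\<^sup>2)))) \<partial>lborel)"
      by (rule nn_integral_cmult) measurable
    also have "\<dots> = ennreal (exp (- (c\<^sup>2 * w))) * ennreal (Gamma ((s + 1) / 2) / 2 * w powr (- ((s + 1) / 2)))"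
      using True s by (subst nn_integral_gaussian_powr) auto
    also have "- ((s + 1) / 2) = (1 - s) / 2 - 1" by (simp add: field_simps)
    finally show ?thesis using True s Gamma_real_nonneg[of "(s + 1) / 2"]
      by (simp add: ennreal_mult''[symmetric] ennreal_mult'[symmetric] mult_ac)
  qed auto
  have "(\<integral>\<^sup>+x. ennreal (indicator {0<..} x * (x powr s / (x\<^sup>2 + c\<^sup>2))) \<partial>lborel) = (\<integral>\<^sup>+x. \<integral>\<^sup>+w. ?f x w \<partial>lborel \<partial>lborel)"
    by (simp only: 1)
  also have "\<dots> = (\<integral>\<^sup>+w. \<integral>\<^sup>+x. ?f x w \<partial>lborel \<partial>lborel)"
    by (rule lborel_pair.Fubini'[symmetric]) measurable
  also have "\<dots> = ennreal (Gamma ((s + 1) / 2) / 2) *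
      (\<integral>\<^sup>+w. ennreal (indicator {0<..} w * (w powr ((1 - s) / 2 - 1) * exp (- (c\<^sup>2 * w)))) \<partial>lborel)"
    unfolding 2 by (rule nn_integral_cmult) measurable
  also have "\<dots> = ennreal (Gamma ((s + 1) / 2) / 2) * ennreal (Gamma ((1 - s) / 2) * (c\<^sup>2) powr (- ((1 - s) / 2)))"
    using s c by (subst nn_integral_exp_powr) auto
  also have "\<dots> = ennreal (Gamma ((s + 1) / 2) * Gamma ((1 - s) / 2) / 2 * (c\<^sup>2) powr (- ((1 - s) / 2)))"
    using s Gamma_real_nonneg[of "(s + 1) / 2"] by (subst ennreal_mult'[symmetric]) (auto simp: mult_ac)
  also have "(c\<^sup>2) powr (- ((1 - s) / 2)) = c powr (s - 1)"
  proof -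
    have "2 * (- ((1 - s) / 2)) = s - 1" by (simp add: diff_divide_distrib)
    then show ?thesis using power2_powr[OF c, of "- ((1 - s) / 2)"] by (simp only:)
  qed
  finally show ?thesis
    unfolding Gamma_reflection_half by (simp add: field_simps)
qed

section \<open>Partial fractions of the hyperbolic cotangent\<close>

text \<open>Euler's product for the sine at the imaginary point \<open>\<i> * t\<close>.\<close>

lemma sinh_product_formula:
  "(\<lambda>n. pi * t * (\<Prod>k<n. 1 + t\<^sup>2 / (real (Suc k))\<^sup>2)) \<longlonglongrightarrow> sinh (pi * t)"
proof -
  have "(\<lambda>n. of_real pi * (\<i> * t) * (\<Prod>k=1..n. 1 - (\<i> * t)\<^sup>2 / of_nat k ^ 2)) \<longlonglongrightarrow> sin (of_real pi * (\<i> * t))"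
    by (rule sin_product_formula_complex)
  then have "(\<lambda>n. Im (of_real pi * (\<i> * t) * (\<Prod>k=1..n. 1 - (\<i> * t)\<^sup>2 / of_nat k ^ 2)))
               \<longlonglongrightarrow> Im (sin (of_real pi * (\<i> * t)))"
    by (rule tendsto_Im)
  moreover have "of_real pi * (\<i> * t) * (\<Prod>k=1..n. 1 - (\<i> * t)\<^sup>2 / of_nat k ^ 2) =
      \<i> * of_real (pi * t * (\<Prod>k<n. 1 + t\<^sup>2 / (real (Suc k))\<^sup>2))" for n
  proof -
    have "(\<Prod>k=1..n. 1 - (\<i> * t)\<^sup>2 / of_nat k ^ 2) = (\<Prod>k<n. 1 - (\<i> * t)\<^sup>2 / of_nat (Suc k) ^ 2)"
      by (simp add: prod.atLeast1_atMost_eq del: of_nat_Suc)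
    also have "\<dots> = of_real (\<Prod>k<n. 1 + t\<^sup>2 / (real (Suc k))\<^sup>2)"
      by (simp add: power_mult_distrib del: of_nat_Suc)
    finally show ?thesis by simp
  qed
  moreover have "Im (sin (of_real pi * (\<i> * t))) = sinh (pi * t)"
    by (simp add: Im_sin sinh_def)
  moreover have "Im (\<i> * of_real r) = r" for r by simp
  ultimately show ?thesis by (simp only:)
qed

text \<open>The logarithmic derivative of the product for \<open>sinh (pi * t) / (pi * t)\<close>;
  uniform convergence of the differentiated series permits termwise differentiation.\<close>

lemma coth_partial_fractions:
  assumes "t > (0::real)"
  shows "(\<lambda>k. 2 * t / (t\<^sup>2 + (real (Suc k))\<^sup>2)) sums (pi * cosh (pi * t) / sinh (pi * t) - 1 / t)"
proof -
  let ?f = "\<lambda>k t. ln (1 + t\<^sup>2 / (real (Suc k))\<^sup>2)"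
  let ?f' = "\<lambda>k t. 2 * t / (t\<^sup>2 + (real (Suc k))\<^sup>2)"
  \<comment> \<open>A bounded interval with \<open>t\<close> in its interior. It contains 0, where
    all logarithms vanish, so the undifferentiated series converges at one point.\<close>
  define S where "S = {0..t + 1}"
  have pos: "1 + u\<^sup>2 / (real (Suc k))\<^sup>2 > 0" for k and u :: real
    by (intro add_pos_nonneg) auto
  have d: "(?f k has_field_derivative ?f' k u) (at u within S)" for k u
  proof -
    have "((\<lambda>u. 1 + u\<^sup>2 / (real (Suc k))\<^sup>2) has_field_derivative 0 + 2 * u / (real (Suc k))\<^sup>2) (at u within S)"
      by (intro DERIV_add DERIV_cdivide) (auto intro!: derivative_eq_intros)
    from DERIV_chain2[OF DERIV_ln[OF pos] this]
    have "(?f k has_field_derivative inverse (1 + u\<^sup>2 / (real (Suc k))\<^sup>2) * (0 + 2 * u / (real (Suc k))\<^sup>2)) (at u within S)" .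
    moreover have "inverse (1 + u\<^sup>2 / c) * (0 + 2 * u / c) = 2 * u / (u\<^sup>2 + c)" if "c > 0" for c
    proof -
      have "u\<^sup>2 + c > 0" using that by (intro add_nonneg_pos) auto
      then show ?thesis using that by (simp add: divide_simps)
    qed
    ultimately show ?thesis by simp
  qed
  have bound: "norm (?f' k u) \<le> 2 * (t + 1) * (1 / (real (Suc k))\<^sup>2)" if "u \<in> S" for k u
  proof -
    have "2 * u / (u\<^sup>2 + (real (Suc k))\<^sup>2) \<le> 2 * (t + 1) / (real (Suc k))\<^sup>2"
      using that assms by (intro frac_le) (auto simp: S_def simp del: of_nat_Suc)
    then show ?thesis using that by (simp add: S_def del: of_nat_Suc)
  qed
  have sq: "summable (\<lambda>k. 1 / (real (Suc k))\<^sup>2)"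
    using inverse_squares_sums by (simp add: sums_iff del: of_nat_Suc) 
  have uc: "uniformly_convergent_on S (\<lambda>n u. \<Sum>k<n. ?f' k u)"
    by (rule Weierstrass_m_test'[OF bound summable_mult[OF sq]])
  have int: "u \<in> interior S" if "0 < u" "u < t + 1" for u
    using that by (simp add: S_def)
  have conv: "convex S" and zero: "0 \<in> S" "summable (\<lambda>k. ?f k 0)"
    using assms by (auto simp: S_def)
  note series = has_field_derivative_series'[of S ?f ?f', OF conv d uc zero]
  have suminf: "(\<Sum>k. ?f k u) = ln (sinh (pi * u) / (pi * u))" if u: "0 < u" "u < t + 1" for u
  proof -
    have "(\<lambda>n. pi * u * (\<Prod>k<n. 1 + u\<^sup>2 / (real (Suc k))\<^sup>2) / (pi * u)) \<longlonglongrightarrow> sinh (pi * u) / (pi * u)"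
      using u by (intro tendsto_divide sinh_product_formula) auto
    then have "(\<lambda>n. \<Prod>k<n. 1 + u\<^sup>2 / (real (Suc k))\<^sup>2) \<longlonglongrightarrow> sinh (pi * u) / (pi * u)"
      using u by simp
    then have "(\<lambda>n. ln (\<Prod>k<n. 1 + u\<^sup>2 / (real (Suc k))\<^sup>2)) \<longlonglongrightarrow> ln (sinh (pi * u) / (pi * u))"
      using u by (intro tendsto_ln) auto
    moreover have "ln (\<Prod>k<n. 1 + u\<^sup>2 / (real (Suc k))\<^sup>2) = (\<Sum>k<n. ?f k u)" for n
      by (intro ln_prod finite_lessThan) (use pos in \<open>metis less_irrefl\<close>)
    ultimately have "(\<lambda>k. ?f k u) sums ln (sinh (pi * u) / (pi * u))"
      by (simp only: sums_def)
    then show ?thesis by (rule sums_unique[symmetric])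
  qed
  have "((\<lambda>u. \<Sum>k. ?f k u) has_field_derivative (\<Sum>k. ?f' k t)) (at t)"
    using series(2)[OF int] assms by simp
  then have "((\<lambda>u. ln (sinh (pi * u) / (pi * u))) has_field_derivative (\<Sum>k. ?f' k t)) (at t)"
    by (rule has_field_derivative_transform_within_open[of _ _ _ "{0<..<t+1}"]) (use suminf assms in auto)
  moreover have "((\<lambda>u. ln (sinh (pi * u) / (pi * u))) has_field_derivative
      (pi * cosh (pi * t) / sinh (pi * t) - 1 / t)) (at t)"
  proof -
    have "((\<lambda>u. ln (sinh (pi * u) / (pi * u))) has_field_derivative
       ((cosh (pi * t) * pi) * (pi * t) - sinh (pi * t) * pi) / (pi * t * (pi * t)) / (sinh (pi * t) / (pi * t))) (at t)"
      using assms by (auto intro!: derivative_eq_intros)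
    moreover have "((cosh (pi * t) * pi) * (pi * t) - sinh (pi * t) * pi) / (pi * t * (pi * t)) / (sinh (pi * t) / (pi * t))
        = pi * cosh (pi * t) / sinh (pi * t) - 1 / t"
      using assms by (simp add: field_simps)
    ultimately show ?thesis by simp
  qed
  ultimately have "(\<Sum>k. ?f' k t) = pi * cosh (pi * t) / sinh (pi * t) - 1 / t"
    by (rule DERIV_unique)
  moreover have "summable (\<lambda>k. ?f' k t)"
    by (rule summable_comparison_test'[OF summable_mult[OF sq] bound]) (use assms in \<open>auto simp: S_def\<close>)
  ultimately show ?thesis by (simp add: sums_iff)
qed

text \<open>The expansion of the hyperbolic cotangent at \<open>t = x / (2 * pi)\<close>, divided by
  \<open>2 * pi\<close>. The sum equals \<open>1 / (exp x - 1) - 1 / x + 1 / 2\<close>.\<close>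

lemma exp_partial_fractions:
  assumes "x > (0::real)"
  shows "(\<lambda>m. 2 * x / (x\<^sup>2 + (2 * pi * real (Suc m))\<^sup>2)) sums
           ((1 + exp (- x)) / (2 * (1 - exp (- x))) - 1 / x)"
proof -
  define t where "t = x / (2 * pi)"
  have t: "t > 0" "x = 2 * pi * t" using assms by (auto simp: t_def)
  have "(\<lambda>k. 2 * t / (t\<^sup>2 + (real (Suc k))\<^sup>2) / (2 * pi)) sums
      ((pi * cosh (pi * t) / sinh (pi * t) - 1 / t) / (2 * pi))"
    by (intro sums_divide coth_partial_fractions t)
  moreover have "2 * t / (t\<^sup>2 + (real (Suc k))\<^sup>2) / (2 * pi) = 2 * x / (x\<^sup>2 + (2 * pi * real (Suc k))\<^sup>2)" for k
  proof -
    have "2 * x / (x\<^sup>2 + (2 * pi * real (Suc k))\<^sup>2) = (4 * pi) * t / ((4 * pi\<^sup>2) * (t\<^sup>2 + (real (Suc k))\<^sup>2))"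
      by (simp add: t(2) power_mult_distrib algebra_simps del: of_nat_Suc)
    also have "\<dots> = 2 * t / (t\<^sup>2 + (real (Suc k))\<^sup>2) / (2 * pi)"
      by (simp add: power2_eq_square del: of_nat_Suc)
    finally show ?thesis ..
  qed
  moreover have "(pi * cosh (pi * t) / sinh (pi * t) - 1 / t) / (2 * pi)
      = (1 + exp (- x)) / (2 * (1 - exp (- x))) - 1 / x"
  proof -
    define E where "E = exp (pi * t)"
    have E: "E > 1" using t by (simp add: E_def)
    have e: "exp (- x) = 1 / E ^ 2"
      by (simp add: E_def t(2) exp_minus field_simps exp_double[symmetric])
    have "E\<^sup>2 - 1 > 0" using E by simp
    moreover have "cosh (pi * t) = (E + 1 / E) / 2" "sinh (pi * t) = (E - 1 / E) / 2"
      by (simp_all add: cosh_def sinh_def E_def exp_minus inverse_eq_divide)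
    moreover have "(E + 1 / E) / 2 / ((E - 1 / E) / 2) = (1 + 1 / E\<^sup>2) / (1 - 1 / E\<^sup>2)"
      using E \<open>E\<^sup>2 - 1 > 0\<close> by (simp add: divide_simps power2_eq_square)
    ultimately have "cosh (pi * t) / sinh (pi * t) = (1 + exp (- x)) / (1 - exp (- x))"
      by (simp only: e)
    then have "pi * cosh (pi * t) / sinh (pi * t) = pi * ((1 + exp (- x)) / (1 - exp (- x)))"
      by (simp only: times_divide_eq_right[symmetric])
    then show ?thesis using t(1) unfolding t(2) by (simp add: diff_divide_distrib mult.commute)
  qed
  ultimately show ?thesis by (simp only:)
qed

section \<open>Exchange of sums and integrals for real s between -1 and 0\<close>

text \<open>
  For \<open>n = 0\<close> the convention \<open>0 powr a = 0\<close> gives the limit value, since both exponents are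
  positive for negative \<open>s\<close>.
\<close>

definition trapezoid_powr :: "nat \<Rightarrow> real \<Rightarrow> real" where
  "trapezoid_powr n s = (real n powr (- s) + (real n + 1) powr (- s)) / 2
                          - ((real n + 1) powr (1 - s) - real n powr (1 - s)) / (1 - s)"

text \<open>The second derivative of \<open>y powr (- s)\<close> carries the factor
  \<open>s * (s + 1)\<close>, which is negative here. Dividing the trapezoidal error by it leaves
  the integral of a nonnegative function.\<close>

lemma nn_integral_trapezoid_powr:
  assumes s: "- 1 < s" "s < 0"
  shows "(\<integral>\<^sup>+y. ennreal (indicator {real n..real n + 1} y *
             ((y - real n) * (real n + 1 - y) / 2 * y powr (- s - 2))) \<partial>lborel)
           = ennreal (trapezoid_powr n s / (s * (s + 1)))"
    and "trapezoid_powr n s / (s * (s + 1)) \<ge> 0"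
proof -
  let ?n = "real n"
  let ?p = "\<lambda>y. (y - ?n) * (?n + 1 - y)"
  have "((\<lambda>y. (?p y / 2) *\<^sub>R (s * (s + 1) * y powr (- s - 2))) has_integral
      ((1/2) *\<^sub>R (?n powr (- s) + (?n + 1) powr (- s)) - ((?n + 1) powr (1 - s) / (1 - s) - ?n powr (1 - s) / (1 - s))))
      {?n..?n+1}"
  proof (rule trapezoid_has_integral[where f' = "\<lambda>y. - s * y powr (- s - 1)"])
    have c: "continuous_on {?n..?n+1} (\<lambda>y. y powr a)" if "a > 0" for a
      using that by (intro continuous_on_powr' continuous_intros) auto
    show "continuous_on {?n..?n+1} (\<lambda>y. y powr (1 - s) / (1 - s))"
      using s by (intro continuous_intros c) auto
    show "continuous_on {?n..?n+1} (\<lambda>y. y powr (- s))"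
      using s by (intro c) auto
    \<comment> \<open>At \<open>y = 0\<close> the derivative of \<open>y powr (- s)\<close> blows up, but the factor \<open>y\<close> of the kernel absorbs this.\<close>
    have "continuous_on {?n..?n+1} (\<lambda>y. (if n = 0 then - s * (1 - y) * y powr (- s) else ?p y *\<^sub>R (- s * y powr (- s - 1))))"
    proof (cases "n = 0")
      case True
      then show ?thesis using c[of "- s"] s by (auto intro!: continuous_intros)
    next
      case False
      then show ?thesis by (auto intro!: continuous_intros)
    qed
    moreover have "(if n = 0 then - s * (1 - y) * y powr (- s) else ?p y *\<^sub>R (- s * y powr (- s - 1)))
        = ?p y *\<^sub>R (- s * y powr (- s - 1))" if "y \<in> {?n..?n+1}" for y
    proof (cases "n = 0 \<and> y > 0")
      case True
      then have "y powr (- s) = y * y powr (- s - 1)" by (simp add: powr_diff)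
      then show ?thesis using True by simp
    next
      case False
      then show ?thesis using that by auto
    qed
    ultimately show "continuous_on {?n..?n+1} (\<lambda>y. ?p y *\<^sub>R (- s * y powr (- s - 1)))"
      by (simp only: cong: continuous_on_cong)
    fix y assume "?n < y"
    then have y: "y > 0" using of_nat_0_le_iff[of n, where ?'a = real] by linarith
    note D = has_real_derivative_powr[OF y]
    show "((\<lambda>y. y powr (1 - s) / (1 - s)) has_vector_derivative y powr (- s)) (at y)"
      unfolding has_real_derivative_iff_has_vector_derivative[symmetric]
      using DERIV_cdivide[OF D[of "1 - s"], of "1 - s"] s by simp
    show "((\<lambda>y. y powr (- s)) has_vector_derivative - s * y powr (- s - 1)) (at y)"
      unfolding has_real_derivative_iff_has_vector_derivative[symmetric]
      using D[of "- s"] by simp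
    show "((\<lambda>y. - s * y powr (- s - 1)) has_vector_derivative s * (s + 1) * y powr (- s - 2)) (at y)"
      unfolding has_real_derivative_iff_has_vector_derivative[symmetric]
      using DERIV_cmult[OF D[of "- s - 1"], of "- s"] by (simp add: algebra_simps)
  qed
  from has_integral_mult_right[OF this, of "1 / (s * (s + 1))"]
  have "((\<lambda>y. 1 / (s * (s + 1)) * ((?p y / 2) *\<^sub>R (s * (s + 1) * y powr (- s - 2)))) has_integral
      trapezoid_powr n s / (s * (s + 1))) {?n..?n+1}"
    by (simp add: trapezoid_powr_def diff_divide_distrib)
  moreover have "1 / (s * (s + 1)) * ((?p y / 2) *\<^sub>R (s * (s + 1) * y powr (- s - 2))) = ?p y / 2 * y powr (- s - 2)" for y
    using s by simp
  ultimately have *: "((\<lambda>y. ?p y / 2 * y powr (- s - 2)) has_integral trapezoid_powr n s / (s * (s + 1))) {?n..?n+1}"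
    by (simp only:)
  show "trapezoid_powr n s / (s * (s + 1)) \<ge> 0"
    using * by (rule has_integral_nonneg) auto
  show "(\<integral>\<^sup>+y. ennreal (indicator {real n..real n + 1} y *
             ((y - real n) * (real n + 1 - y) / 2 * y powr (- s - 2))) \<partial>lborel)
           = ennreal (trapezoid_powr n s / (s * (s + 1)))"
    by (rule nn_integral_has_integral_lebesgue[OF _ *]) auto
qed

text \<open>The trapezoidal error of \<open>exp (- (y * x))\<close> as a function of
  \<open>y\<close> on \<open>[n, n + 1]\<close>, with \<open>exp (- x) ^ n\<close> pulled out so
  that summing over \<open>n\<close> is a geometric series.\<close>

definition trapezoid_exp :: "nat \<Rightarrow> real \<Rightarrow> real" where
  "trapezoid_exp n x = exp (- x) ^ n * ((1 + exp (- x)) / 2 - (1 - exp (- x)) / x)"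

lemma nn_integral_trapezoid_exp:
  assumes x: "x > 0"
  shows "(\<integral>\<^sup>+y. ennreal (indicator {real n..real n + 1} y *
             ((y - real n) * (real n + 1 - y) / 2 * exp (- (y * x)))) \<partial>lborel)
           = ennreal (trapezoid_exp n x / x\<^sup>2)"
    and "trapezoid_exp n x / x\<^sup>2 \<ge> 0"
proof -
  let ?n = "real n"
  let ?p = "\<lambda>y. (y - ?n) * (?n + 1 - y)"
  let ?e = "\<lambda>y. exp (- (y * x))"
  have "((\<lambda>y. (?p y / 2) *\<^sub>R (x\<^sup>2 * ?e y)) has_integral
      ((1/2) *\<^sub>R (?e ?n + ?e (?n + 1)) - (- ?e (?n + 1) / x - (- ?e ?n / x)))) {?n..?n+1}"
  proof (rule trapezoid_has_integral[where f' = "\<lambda>y. - x * ?e y"])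
    fix y
    show "((\<lambda>y. - ?e y / x) has_vector_derivative ?e y) (at y)"
      "(?e has_vector_derivative - x * ?e y) (at y)"
      "((\<lambda>y. - x * ?e y) has_vector_derivative x\<^sup>2 * ?e y) (at y)"
      unfolding has_real_derivative_iff_has_vector_derivative[symmetric]
      using x by (auto intro!: derivative_eq_intros simp: power2_eq_square)
  qed (use x in \<open>auto intro!: continuous_intros\<close>)
  moreover have "?e (?n + 1) = exp (- x) ^ n * exp (- x)" "?e ?n = exp (- x) ^ n"
    by (simp_all add: exp_of_nat_mult[symmetric] exp_add[symmetric] algebra_simps)
  ultimately have "((\<lambda>y. (?p y / 2) *\<^sub>R (x\<^sup>2 * ?e y)) has_integral trapezoid_exp n x) {?n..?n+1}"
    by (simp add: trapezoid_exp_def algebra_simps diff_divide_distrib add_divide_distrib)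
  from has_integral_mult_right[OF this, of "1 / x\<^sup>2"]
  have *: "((\<lambda>y. ?p y / 2 * ?e y) has_integral trapezoid_exp n x / x\<^sup>2) {?n..?n+1}"
    using x by (simp add: mult.assoc)
  show "trapezoid_exp n x / x\<^sup>2 \<ge> 0"
    using * by (rule has_integral_nonneg) auto
  show "(\<integral>\<^sup>+y. ennreal (indicator {real n..real n + 1} y *
             ((y - real n) * (real n + 1 - y) / 2 * exp (- (y * x)))) \<partial>lborel)
           = ennreal (trapezoid_exp n x / x\<^sup>2)"
    by (rule nn_integral_has_integral_lebesgue[OF _ *]) auto
qed

lemma trapezoid_exp_sums:
  assumes "x > 0"
  shows "(\<lambda>n. trapezoid_exp n x / x\<^sup>2) sums (((1 + exp (- x)) / (2 * (1 - exp (- x))) - 1 / x) / x\<^sup>2)"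
proof -
  have "(\<lambda>n. trapezoid_exp n x) sums (1 / (1 - exp (- x)) * ((1 + exp (- x)) / 2 - (1 - exp (- x)) / x))"
    unfolding trapezoid_exp_def using assms by (intro sums_mult2 geometric_sums) auto
  also have "1 / (1 - exp (- x)) * ((1 + exp (- x)) / 2 - (1 - exp (- x)) / x)
      = (1 + exp (- x)) / (2 * (1 - exp (- x))) - 1 / x"
  proof -
    have "1 / d * (a / 2 - d / x) = a / (2 * d) - 1 / x" if "d \<noteq> 0" for a d
      using that by (simp add: right_diff_distrib)
    then show ?thesis using assms by simp
  qed
  finally show ?thesis by (rule sums_divide)
qed

lemma suminf_ennreal_sums: "(\<And>i. 0 \<le> f i) \<Longrightarrow> f sums a \<Longrightarrow> (\<Sum>i. ennreal (f i)) = ennreal a"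
  by (simp add: sums_iff suminf_ennreal2)

text \<open>The weight \<open>x powr (s + 1)\<close> is chosen so that integrating it against
  \<open>exp (- (y * x))\<close> yields \<open>Gamma (s + 2) * y powr (- s - 2)\<close>, the power
  in the second derivative of \<open>y powr (- s)\<close>.\<close>

lemma nn_integral_trapezoid_swap:
  assumes s: "- 1 < s" "s < 0"
  shows "ennreal (Gamma (s + 2) * (trapezoid_powr n s / (s * (s + 1)))) =
     (\<integral>\<^sup>+x. ennreal (indicator {0<..} x * (x powr (s + 1) * (trapezoid_exp n x / x\<^sup>2))) \<partial>lborel)"
proof -
  \<comment> \<open>The Peano kernel cut off to \<open>[n, n + 1]\<close>. It is 0 for
    \<open>y \<le> 0\<close>, also at \<open>y = 0\<close> when \<open>n = 0\<close>, which silences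
    the divergent integrals over \<open>x\<close> there.\<close>
  define q where "q = (\<lambda>y. indicator {real n..real n + 1} y * ((y - real n) * (real n + 1 - y) / 2))"
  have q [measurable]: "q \<in> borel_measurable borel" unfolding q_def by measurable
  have q0: "q y \<ge> 0" "y \<le> 0 \<Longrightarrow> q y = 0" for y
    unfolding q_def by (auto simp: indicator_def)
  let ?F = "\<lambda>y x. ennreal (q y) * ennreal (indicator {0<..} x * (x powr (s + 1) * exp (- (y * x))))"
  have "(\<integral>\<^sup>+x. ?F y x \<partial>lborel) = ennreal (Gamma (s + 2)) * ennreal (q y * y powr (- s - 2))" for y
  proof (cases "y > 0")
    case True
    have "(\<integral>\<^sup>+x. ?F y x \<partial>lborel) = ennreal (q y) *
        (\<integral>\<^sup>+x. ennreal (indicator {0<..} x * (x powr ((s + 2) - 1) * exp (- (y * x)))) \<partial>lborel)"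
      by (subst nn_integral_cmult[symmetric]) (measurable, simp add: add.commute)
    also have "\<dots> = ennreal (q y) * ennreal (Gamma (s + 2) * y powr (- (s + 2)))"
      using True s by (subst nn_integral_exp_powr) auto
    also have "\<dots> = ennreal (Gamma (s + 2)) * ennreal (q y * y powr (- s - 2))"
      using s q0 Gamma_real_nonneg[of "s + 2"] by (simp add: ennreal_mult'[symmetric] mult_ac)
    finally show ?thesis .
  qed (use q0 in auto)
  then have "(\<integral>\<^sup>+y. \<integral>\<^sup>+x. ?F y x \<partial>lborel \<partial>lborel) = (\<integral>\<^sup>+y. ennreal (Gamma (s + 2)) * ennreal (q y * y powr (- s - 2)) \<partial>lborel)"
    by (simp only:)
  also have "\<dots> = ennreal (Gamma (s + 2)) * (\<integral>\<^sup>+y. ennreal (q y * y powr (- s - 2)) \<partial>lborel)"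
    by (rule nn_integral_cmult) measurable
  also have "(\<integral>\<^sup>+y. ennreal (q y * y powr (- s - 2)) \<partial>lborel) = ennreal (trapezoid_powr n s / (s * (s + 1)))"
    unfolding nn_integral_trapezoid_powr(1)[OF s, symmetric] q_def by (simp only: mult.assoc)
  also have "ennreal (Gamma (s + 2)) * \<dots> = ennreal (Gamma (s + 2) * (trapezoid_powr n s / (s * (s + 1))))"
    using s Gamma_real_nonneg[of "s + 2"] by (subst ennreal_mult') auto
  finally have "ennreal (Gamma (s + 2) * (trapezoid_powr n s / (s * (s + 1)))) = (\<integral>\<^sup>+y. \<integral>\<^sup>+x. ?F y x \<partial>lborel \<partial>lborel)" ..
  also have "\<dots> = (\<integral>\<^sup>+x. \<integral>\<^sup>+y. ?F y x \<partial>lborel \<partial>lborel)"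
    by (rule lborel_pair.Fubini'[symmetric]) measurable
  also have "\<dots> = (\<integral>\<^sup>+x. ennreal (indicator {0<..} x * (x powr (s + 1) * (trapezoid_exp n x / x\<^sup>2))) \<partial>lborel)"
  proof (rule nn_integral_cong)
    fix x :: real
    show "(\<integral>\<^sup>+y. ?F y x \<partial>lborel) = ennreal (indicator {0<..} x * (x powr (s + 1) * (trapezoid_exp n x / x\<^sup>2)))"
    proof (cases "x > 0")
      case True
      have "(\<integral>\<^sup>+y. ?F y x \<partial>lborel) = (\<integral>\<^sup>+y. ennreal (x powr (s + 1)) * ennreal (q y * exp (- (y * x))) \<partial>lborel)"
        using True q0 by (intro nn_integral_cong) (simp add: ennreal_mult'[symmetric] mult_ac)
      also have "\<dots> = ennreal (x powr (s + 1)) * (\<integral>\<^sup>+y. ennreal (q y * exp (- (y * x))) \<partial>lborel)"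
        by (rule nn_integral_cmult) measurable
      also have "(\<integral>\<^sup>+y. ennreal (q y * exp (- (y * x))) \<partial>lborel) = ennreal (trapezoid_exp n x / x\<^sup>2)"
        unfolding nn_integral_trapezoid_exp(1)[OF True, symmetric] q_def by (simp only: mult.assoc)
      finally show ?thesis using True by (simp add: ennreal_mult'[symmetric])
    qed simp
  qed
  finally show ?thesis .
qed

text \<open>Both sides are the integral of \<open>x powr (s - 1) * ?G\<close>: on the left
  \<open>?G\<close> arises as a sum over the intervals \<open>[n, n + 1]\<close>, on the right as a
  sum of partial fractions with \<open>c = 2 * pi * real (Suc m)\<close>.\<close>

lemma suminf_trapezoid:
  assumes s: "- 1 < s" "s < 0"
  shows "(\<Sum>n. ennreal (Gamma (s + 2) * (trapezoid_powr n s / (s * (s + 1))))) =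
     (\<Sum>m. ennreal (pi / cos (pi * s / 2) * (2 * pi * real (Suc m)) powr (s - 1)))"
proof -
  have [measurable]: "(\<lambda>x. trapezoid_exp n x) \<in> borel_measurable borel" for n
    unfolding trapezoid_exp_def by measurable
  have "(\<Sum>n. ennreal (Gamma (s + 2) * (trapezoid_powr n s / (s * (s + 1))))) =
     (\<integral>\<^sup>+x. (\<Sum>n. ennreal (indicator {0<..} x * (x powr (s + 1) * (trapezoid_exp n x / x\<^sup>2)))) \<partial>lborel)"
    unfolding nn_integral_trapezoid_swap[OF s] by (rule nn_integral_suminf[symmetric]) measurable
  also have "\<dots> = (\<integral>\<^sup>+x. (\<Sum>m. ennreal 2 * ennreal (indicator {0<..} x * (x powr s / (x\<^sup>2 + (2 * pi * real (Suc m))\<^sup>2)))) \<partial>lborel)"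
  proof (rule nn_integral_cong)
    fix x :: real
    show "(\<Sum>n. ennreal (indicator {0<..} x * (x powr (s + 1) * (trapezoid_exp n x / x\<^sup>2)))) =
       (\<Sum>m. ennreal 2 * ennreal (indicator {0<..} x * (x powr s / (x\<^sup>2 + (2 * pi * real (Suc m))\<^sup>2))))"
    proof (cases "x > 0")
      case True
      let ?G = "(1 + exp (- x)) / (2 * (1 - exp (- x))) - 1 / x"
      have "(\<Sum>n. ennreal (indicator {0<..} x * (x powr (s + 1) * (trapezoid_exp n x / x\<^sup>2)))) = ennreal (x powr (s + 1) * (?G / x\<^sup>2))"
      proof (rule suminf_ennreal_sums)
        show "0 \<le> indicator {0<..} x * (x powr (s + 1) * (trapezoid_exp n x / x\<^sup>2))" for n
          using nn_integral_trapezoid_exp(2)[OF True] by (intro mult_nonneg_nonneg) auto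
        show "(\<lambda>n. indicator {0<..} x * (x powr (s + 1) * (trapezoid_exp n x / x\<^sup>2))) sums (x powr (s + 1) * (?G / x\<^sup>2))"
          using sums_mult[OF trapezoid_exp_sums[OF True], of "x powr (s + 1)"] True by simp
      qed
      moreover have "(\<Sum>m. ennreal 2 * ennreal (indicator {0<..} x * (x powr s / (x\<^sup>2 + (2 * pi * real (Suc m))\<^sup>2)))) = ennreal (x powr (s - 1) * ?G)"
      proof -
        have e: "ennreal 2 * ennreal (indicator {0<..} x * (x powr s / (x\<^sup>2 + (2 * pi * real (Suc m))\<^sup>2)))
            = ennreal (x powr (s - 1) * (2 * x / (x\<^sup>2 + (2 * pi * real (Suc m))\<^sup>2)))" for m
        proof -
          have "x powr s = x powr (s - 1) * x" using True by (simp add: powr_diff)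
          then show ?thesis using True by (subst ennreal_mult'[symmetric]) (auto simp: mult_ac simp del: of_nat_Suc)
        qed
        show ?thesis
          unfolding e by (rule suminf_ennreal_sums[OF _ sums_mult[OF exp_partial_fractions[OF True]]])
            (use True in \<open>auto intro!: mult_nonneg_nonneg divide_nonneg_nonneg\<close>)
      qed
      moreover have "x powr (s + 1) * (?G / x\<^sup>2) = x powr (s - 1) * ?G"
        using True by (simp add: powr_add powr_diff power2_eq_square)
      ultimately show ?thesis by (simp only:)
    qed simp
  qed
  also have "\<dots> = (\<Sum>m. \<integral>\<^sup>+x. ennreal 2 * ennreal (indicator {0<..} x * (x powr s / (x\<^sup>2 + (2 * pi * real (Suc m))\<^sup>2))) \<partial>lborel)"
    by (rule nn_integral_suminf) measurable
  also have "\<dots> = (\<Sum>m. ennreal (pi / cos (pi * s / 2) * (2 * pi * real (Suc m)) powr (s - 1)))"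
  proof (rule suminf_cong)
    fix m
    have "(\<integral>\<^sup>+x. ennreal 2 * ennreal (indicator {0<..} x * (x powr s / (x\<^sup>2 + (2 * pi * real (Suc m))\<^sup>2))) \<partial>lborel)
        = ennreal 2 * (\<integral>\<^sup>+x. ennreal (indicator {0<..} x * (x powr s / (x\<^sup>2 + (2 * pi * real (Suc m))\<^sup>2))) \<partial>lborel)"
      by (rule nn_integral_cmult) measurable
    also have "\<dots> = ennreal 2 * ennreal (pi / (2 * cos (pi * s / 2)) * (2 * pi * real (Suc m)) powr (s - 1))"
      using s by (subst nn_integral_powr_over_quadratic) auto
    also have "\<dots> = ennreal (pi / cos (pi * s / 2) * (2 * pi * real (Suc m)) powr (s - 1))"
      by (subst ennreal_mult'[symmetric]) auto
    finally show "(\<integral>\<^sup>+x. ennreal 2 * ennreal (indicator {0<..} x * (x powr s / (x\<^sup>2 + (2 * pi * real (Suc m))\<^sup>2))) \<partial>lborel)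
        = ennreal (pi / cos (pi * s / 2) * (2 * pi * real (Suc m)) powr (s - 1))" .
  qed
  finally show ?thesis .
qed

lemma zeta_term_of_real:
  assumes "s \<noteq> (1::real)"
  shows "zeta_term n (of_real s) = of_real ((s - 1) * trapezoid_powr n s)"
proof -
  have p: "of_nat m powr (of_real a) = complex_of_real (real m powr a)" for m a
    using powr_of_real[of "real m" a] by simp
  have "zeta_term n (of_real s) = (of_real s - 1) * (of_nat n powr (of_real (- s)) + of_nat (Suc n) powr (of_real (- s))) / 2
                     + (of_nat (Suc n) powr (of_real (1 - s)) - of_nat n powr (of_real (1 - s)))"
    by (simp add: zeta_term_def del: of_nat_Suc)
  also have "\<dots> = of_real ((s - 1) * (real n powr (- s) + real (Suc n) powr (- s)) / 2
                     + (real (Suc n) powr (1 - s) - real n powr (1 - s)))"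
    unfolding p by (simp del: of_nat_Suc)
  also have "(s - 1) * (real n powr (- s) + real (Suc n) powr (- s)) / 2
                     + (real (Suc n) powr (1 - s) - real n powr (1 - s)) = (s - 1) * trapezoid_powr n s"
  proof -
    have "(s - 1) * (a / 2 - b / (1 - s)) = (s - 1) * a / 2 + b" for a b
      using assms by (simp add: field_simps)
    then show ?thesis by (simp add: trapezoid_powr_def add.commute)
  qed
  finally show ?thesis .
qed

lemma trapezoid_powr_sums:
  assumes "- 1 < s" "s < 0"
  shows "(\<lambda>n. trapezoid_powr n s) sums (Re (zeta_reg (of_real s)) / (s - 1))"
    and "zeta_reg (of_real s) = of_real (Re (zeta_reg (of_real s)))"
proof -
  \<comment> \<open>With \<open>0 powr a = 0\<close>, the term at 0 is exactly the summand
    \<open>(s + 1) / 2\<close> of \<open>zeta_reg\<close>, so the whole value becomes one series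
    starting at 0.\<close>
  have "zeta_term 0 (of_real s) = (of_real s + 1) / 2"
  proof -
    have "(of_real s :: complex) \<noteq> 1" using assms by (simp add: complex_eq_iff)
    then show ?thesis using assms by (simp add: zeta_term_def field_simps)
  qed
  moreover have "(\<lambda>n. zeta_term n (of_real s)) sums
      (zeta_reg (of_real s) - (of_real s + 1) / 2 + zeta_term 0 (of_real s))"
    by (rule sums_Suc[OF zeta_term_sums]) (use assms in simp)
  ultimately have "(\<lambda>n. zeta_term n (of_real s)) sums zeta_reg (of_real s)"
    by (simp only: diff_add_cancel)
  then have *: "(\<lambda>n. of_real ((s - 1) * trapezoid_powr n s)) sums zeta_reg (of_real s)"
    using assms by (simp only: zeta_term_of_real)
  from sums_Re[OF this] have "(\<lambda>n. (s - 1) * trapezoid_powr n s) sums Re (zeta_reg (of_real s))"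
    by simp
  from sums_divide[OF this, of "s - 1"] assms
  show "(\<lambda>n. trapezoid_powr n s) sums (Re (zeta_reg (of_real s)) / (s - 1))"
    by simp
  from sums_Im[OF *] have "Im (zeta_reg (of_real s)) = 0"
    by (simp add: sums_iff)
  then show "zeta_reg (of_real s) = of_real (Re (zeta_reg (of_real s)))"
    by (simp add: complex_eq_iff)
qed

section \<open>The reflection factor and the passage to complex s\<close>

text \<open>The factor in Riemann's equation
  \<open>zeta s = zeta_factor s * zeta (1 - s)\<close>.\<close>

definition zeta_factor :: "complex \<Rightarrow> complex" where
  "zeta_factor s = 2 * of_real (2 * pi) powr (s - 1) * sin (of_real pi * s / 2) * Gamma (1 - s)"

lemma zeta_factor_holomorphic: "zeta_factor holomorphic_on {s. Re s < 1}"
  unfolding zeta_factor_def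
  by (intro holomorphic_intros) (auto elim!: nonpos_Ints_cases simp: complex_eq_iff)

text \<open>The sine vanishes only at even integers \<open>s\<close>, and \<open>Gamma\<close> is 0
  only at its poles, by its default value there; neither occurs in the open strip.\<close>

lemma zeta_factor_nonzero:
  assumes "0 < Re s" "Re s < 1"
  shows "zeta_factor s \<noteq> 0"
proof -
  have "1 - s \<notin> \<int>\<^sub>\<le>\<^sub>0"
    using assms by (auto elim!: nonpos_Ints_cases simp: complex_eq_iff)
  moreover have "sin (of_real pi * s / 2) \<noteq> 0"
  proof
    assume "sin (of_real pi * s / 2) = 0"
    then obtain n :: int where "of_real pi * s / 2 = of_real (n * pi)"
      unfolding sin_eq_0 by auto
    then have "Re (of_real pi * s / 2) = n * pi" by simp
    then have "Re s = 2 * of_int n" by (simp add: field_simps)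
    then have "0 < real_of_int n" "real_of_int n < 1" using assms by linarith+
    then have "0 < n" "n < 1" by simp_all
    then show False by simp
  qed
  ultimately show ?thesis
    by (simp add: zeta_factor_def Gamma_eq_zero_iff)
qed

text \<open>Rewrites the factor into the constants that the integrals produce: reflection turns
  \<open>Gamma (1 - s)\<close> into \<open>1 / Gamma s\<close>, the double angle formula splits
  \<open>sin (pi * s)\<close>, and \<open>Gamma (s + 2) = (s + 1) * (s * Gamma s)\<close>.\<close>

lemma zeta_factor_of_real:
  assumes "- 1 < s" "s < 0"
  shows "zeta_factor (of_real s) =
     of_real (s * (s + 1) / Gamma (s + 2) * (pi / cos (pi * s / 2)) * (2 * pi) powr (s - 1))"
proof -
  let ?h = "pi * s / 2"
  have h: "- (pi / 2) < ?h" "?h < 0"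
    using mult_strict_left_mono[OF assms(1) pi_gt_zero] mult_pos_neg[OF pi_gt_zero assms(2)] by simp_all
  then have c: "cos ?h > 0" using pi_gt_zero by (intro cos_gt_zero_pi) linarith+
  have sn: "sin ?h \<noteq> 0" using sin_gt_zero[of "- ?h"] h by auto
  have G: "Gamma (s + 2) = (s + 1) * (s * Gamma s)"
  proof -
    have "s \<notin> \<int>\<^sub>\<le>\<^sub>0" "s + 1 \<notin> \<int>\<^sub>\<le>\<^sub>0"
      using assms by (auto elim!: nonpos_Ints_cases)
    then show ?thesis using Gamma_plus1[of s] Gamma_plus1[of "s + 1"] by (simp add: add.assoc)
  qed
  have Gp: "Gamma (s + 2) > 0" using assms by (intro Gamma_real_pos) auto
  have "Gamma s * Gamma (1 - s) = pi / (2 * sin ?h * cos ?h)"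
    using Gamma_reflection_real[of s] sin_double[of ?h] by simp
  then have "2 * sin ?h * Gamma (1 - s) = s * (s + 1) / Gamma (s + 2) * (pi / cos ?h)"
  proof -
    have "Gamma s \<noteq> 0" using Gp unfolding G by auto
    moreover have e: "s * (s + 1) / Gamma (s + 2) = 1 / Gamma s"
      unfolding G using assms by simp
    ultimately show ?thesis
      unfolding e using c sn \<open>Gamma s * Gamma (1 - s) = pi / (2 * sin ?h * cos ?h)\<close> by (simp add: field_simps)
  qed
  moreover have "zeta_factor (of_real s) = of_real (2 * sin ?h * Gamma (1 - s) * (2 * pi) powr (s - 1))"
  proof -
    have "of_real (2 * pi) powr (of_real s - 1 :: complex) = of_real ((2 * pi) powr (s - 1))"
      using powr_of_real[of "2 * pi" "s - 1"] by simp
    moreover have "sin (of_real pi * of_real s / 2 :: complex) = of_real (sin ?h)"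
      by (simp flip: sin_of_real)
    moreover have "Gamma (1 - of_real s :: complex) = of_real (Gamma (1 - s))"
      using Gamma_complex_of_real[of "1 - s"] by simp
    ultimately show ?thesis by (simp only: zeta_factor_def of_real_mult of_real_numeral mult_ac)
  qed
  ultimately show ?thesis by (simp only:)
qed

text \<open>Riemann's equation with the denominators \<open>s - 1\<close> and \<open>- s\<close> of
  the two zeta values cleared. It compares the values of the two series in
  \<open>suminf_trapezoid\<close>.\<close>

lemma zeta_reg_functional_equation_real:
  assumes s: "- 1 < s" "s < 0"
  shows "of_real s * zeta_reg (of_real s) = zeta_factor (of_real s) * (1 - of_real s) * zeta_reg (1 - of_real s)"
proof -
  \<comment> \<open>\<open>Z\<close> is \<open>zeta_reg\<close> at \<open>s\<close>, which is real;
    \<open>D\<close> is the Dirichlet series at \<open>1 - s\<close>, convergent because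
    \<open>s < 0\<close>; \<open>K\<close> collects the constants of the partial fraction
    side.\<close>
  define Z where "Z = Re (zeta_reg (of_real s))"
  define D where "D = (\<Sum>m. real (Suc m) powr (s - 1))"
  define K where "K = pi / cos (pi * s / 2) * (2 * pi) powr (s - 1)"
  have "- (pi / 2) < pi * s / 2" "pi * s / 2 < 0"
    using mult_strict_left_mono[OF s(1) pi_gt_zero] mult_pos_neg[OF pi_gt_zero s(2)] by simp_all
  then have c: "cos (pi * s / 2) > 0" using pi_gt_zero by (intro cos_gt_zero_pi) linarith+
  have Gp: "Gamma (s + 2) > 0" using s by (intro Gamma_real_pos) auto
  have "summable (\<lambda>m. real m powr (s - 1))"
    using s by (subst summable_real_powr_iff) auto
  then have Dsum: "(\<lambda>m. real (Suc m) powr (s - 1)) sums D"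
    unfolding D_def by (subst (asm) summable_Suc_iff[symmetric]) (rule summable_sums)
  have "ennreal (Gamma (s + 2) * (Z / (s - 1) / (s * (s + 1)))) =
     (\<Sum>n. ennreal (Gamma (s + 2) * (trapezoid_powr n s / (s * (s + 1)))))"
    using nn_integral_trapezoid_powr(2)[OF s] Gp trapezoid_powr_sums(1)[OF s, folded Z_def]
    by (intro suminf_ennreal_sums[symmetric] sums_mult sums_divide mult_nonneg_nonneg) auto
  also have "\<dots> = (\<Sum>m. ennreal (pi / cos (pi * s / 2) * (2 * pi * real (Suc m)) powr (s - 1)))"
    by (rule suminf_trapezoid[OF s])
  also have "\<dots> = (\<Sum>m. ennreal (K * real (Suc m) powr (s - 1)))"
    by (simp add: powr_mult K_def mult.assoc del: of_nat_Suc)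
  also have "\<dots> = ennreal (K * D)"
    using Dsum c by (intro suminf_ennreal_sums sums_mult mult_nonneg_nonneg) (auto simp: K_def)
  finally have "Gamma (s + 2) * (Z / (s - 1) / (s * (s + 1))) = K * D"
  proof (subst (asm) ennreal_inj)
    have "0 \<le> Z / (s - 1) / (s * (s + 1))"
      by (rule sums_le[OF _ sums_zero sums_divide[OF trapezoid_powr_sums(1)[OF s, folded Z_def]]])
         (rule nn_integral_trapezoid_powr(2)[OF s])
    then show "0 \<le> Gamma (s + 2) * (Z / (s - 1) / (s * (s + 1)))" using Gp by (intro mult_nonneg_nonneg) simp_all
    have "0 \<le> D" by (rule sums_le[OF _ sums_zero Dsum]) simp
    then show "0 \<le> K * D" using c by (simp add: K_def)
  qed
  then have Z: "Z = (s - 1) * (s * (s + 1) / Gamma (s + 2) * K) * D"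
  proof -
    have "z = a * (b / g * k) * d" if "g * (z / a / b) = k * d" "a \<noteq> 0" "b \<noteq> 0" "g \<noteq> 0"
      for a b d g k z :: real
      using that by (simp add: field_simps)
    moreover have "s - 1 \<noteq> 0" "s * (s + 1) \<noteq> 0" using s by auto
    moreover have "Gamma (s + 2) \<noteq> 0" using Gp by (rule less_imp_neq[symmetric])
    ultimately show ?thesis
      using \<open>Gamma (s + 2) * (Z / (s - 1) / (s * (s + 1))) = K * D\<close> by blast
  qed
  have "(\<Sum>n. of_nat (Suc n) powr (- (1 - of_real s)) :: complex) = of_real D"
  proof -
    have "of_nat (Suc n) powr (- (1 - of_real s)) = complex_of_real (real (Suc n) powr (s - 1))" for n
      using powr_of_real[of "real (Suc n)" "s - 1"] by (simp del: of_nat_Suc)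
    then show ?thesis using sums_of_real[OF Dsum, where ?'a = complex] by (simp only: sums_iff)
  qed
  then have "zeta_reg (1 - of_real s) = - of_real s * of_real D"
    using zeta_reg_eq_Dirichlet[of "1 - of_real s"] s by simp
  moreover have "zeta_reg (of_real s) = of_real Z"
    using trapezoid_powr_sums(2)[OF s] by (simp only: Z_def)
  moreover have "zeta_factor (of_real s) = of_real (s * (s + 1) / Gamma (s + 2) * K)"
    unfolding zeta_factor_of_real[OF s] K_def by (simp only: mult.assoc)
  moreover have "s * Z = (s * (s + 1) / Gamma (s + 2) * K) * (1 - s) * (- s * D)"
    unfolding Z by (simp add: algebra_simps)
  then have "of_real (s * Z) = complex_of_real ((s * (s + 1) / Gamma (s + 2) * K) * (1 - s) * (- s * D))"
    by (simp only:)
  ultimately show ?thesis by (simp only: of_real_mult of_real_diff of_real_1 of_real_minus)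
qed

lemma zeta_reg_functional_equation:
  assumes "- 1 < Re s" "Re s < 1"
  shows "s * zeta_reg s = zeta_factor s * (1 - s) * zeta_reg (1 - s)"
proof -
  define T where "T = {s::complex. - 1 < Re s \<and> Re s < 1}"
  have T: "T = {s. Re s > - 1} \<inter> {s. Re s < 1}" by (auto simp: T_def)
  have opn: "open T" unfolding T by (intro open_Int open_halfspace_Re_gt open_halfspace_Re_lt)
  have con: "connected T"
    unfolding T by (intro convex_connected convex_Int convex_halfspace_Re_gt convex_halfspace_Re_lt)
  define U where "U = complex_of_real ` {- 1<..<0}"
  have hol1: "zeta_reg holomorphic_on T"
    by (rule holomorphic_on_subset[OF zeta_reg_holomorphic]) (auto simp: T)
  have "(zeta_reg \<circ> (\<lambda>s. 1 - s)) holomorphic_on T"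
    by (rule holomorphic_on_compose_gen[OF _ zeta_reg_holomorphic]) (auto intro!: holomorphic_intros simp: T)
  then have hol2: "(\<lambda>s. zeta_reg (1 - s)) holomorphic_on T" by (simp add: o_def)
  have hol3: "zeta_factor holomorphic_on T"
    by (rule holomorphic_on_subset[OF zeta_factor_holomorphic]) (auto simp: T)
  have "s * zeta_reg s - zeta_factor s * (1 - s) * zeta_reg (1 - s) = 0"
  \<comment> \<open>The equation is known on the real segment from -1 to 0, and
    \<open>- 1 / 2\<close> serves as an accumulation point of it inside the connected strip.\<close>
  proof (rule analytic_continuation[OF _ opn con, where U = U and \<xi> = "of_real (- 1 / 2)"
        and f = "\<lambda>s. s * zeta_reg s - zeta_factor s * (1 - s) * zeta_reg (1 - s)"])
    show "(\<lambda>s. s * zeta_reg s - zeta_factor s * (1 - s) * zeta_reg (1 - s)) holomorphic_on T"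
      by (intro holomorphic_intros hol1 hol2 hol3)
    show "U \<subseteq> T" by (auto simp: U_def T)
    show "of_real (- 1 / 2) \<in> T" by (simp add: T)
    show "of_real (- 1 / 2) islimpt U"
    proof -
      have "(- 1 / 2 :: real) islimpt {- 1<..<0}"
        by (intro open_imp_islimpt) auto
      moreover have "\<forall>\<^sub>F y in at (- 1 / 2). complex_of_real y \<noteq> of_real (- 1 / 2)"
        unfolding of_real_eq_iff by (simp add: eventually_at_filter)
      ultimately show ?thesis
        unfolding U_def by (intro islimpt_isCont_image) auto
    qed
    show "s * zeta_reg s - zeta_factor s * (1 - s) * zeta_reg (1 - s) = 0" if "s \<in> U" for s
      using that zeta_reg_functional_equation_real by (auto simp: U_def)
    show "s \<in> T" using assms by (simp add: T)
  qed
  then show ?thesis by simp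
qed

lemma zeta_reg_nonzero_Re_ge_1: "Re s \<ge> 1 \<Longrightarrow> zeta_reg s \<noteq> 0"
  using zeta_reg_nonzero_Re_gt_1[of s] zeta_reg_nonzero_Re_eq_1[of s] by linarith

section \<open>Continuation to the punctured plane\<close>

text \<open>The second branch is the functional equation, with
  \<open>zeta_reg (1 - s) / (- s)\<close> standing for the zeta value at \<open>1 - s\<close>. At 1
  division by 0 gives 0, as the normalisation of \<open>zeta\<close> demands.\<close>

definition zeta_cont :: "complex \<Rightarrow> complex" where
  "zeta_cont s = (if Re s > - 1 then zeta_reg s / (s - 1)
                  else zeta_factor s * (zeta_reg (1 - s) / (- s)))"

text \<open>The branches agree for real parts between -1 and 0, so each formula is valid on an open
  set and the two sets cover the punctured plane.\<close>

lemma zeta_cont_reflect: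
  assumes "Re s < 0"
  shows "zeta_cont s = zeta_factor s * (zeta_reg (1 - s) / (- s))"
proof (cases "Re s > - 1")
  case True
  have "s \<noteq> 0" "s - 1 \<noteq> 0" using assms by auto
  have "zeta_reg s = zeta_factor s * (1 - s) * zeta_reg (1 - s) / s"
    using zeta_reg_functional_equation[of s] True assms \<open>s \<noteq> 0\<close> by (simp add: field_simps)
  then have "zeta_reg s / (s - 1) = zeta_factor s * (zeta_reg (1 - s) / (- s))"
    using \<open>s \<noteq> 0\<close> \<open>s - 1 \<noteq> 0\<close> by (simp add: field_simps)
  then show ?thesis using True by (simp add: zeta_cont_def)
qed (simp add: zeta_cont_def)

lemma zeta_cont_holomorphic: "zeta_cont holomorphic_on (- {1})"
proof -
  have "zeta_cont holomorphic_on ({s. Re s > - 1} - {1}) \<union> {s. Re s < 0}"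
  proof (rule holomorphic_on_Un)
    have "zeta_reg holomorphic_on {s. Re s > - 1} - {1}"
      by (rule holomorphic_on_subset[OF zeta_reg_holomorphic]) auto
    then have "(\<lambda>s. zeta_reg s / (s - 1)) holomorphic_on {s. Re s > - 1} - {1}"
      by (intro holomorphic_intros) auto
    then show "zeta_cont holomorphic_on {s. Re s > - 1} - {1}"
      by (rule holomorphic_transform) (simp add: zeta_cont_def)
    have "(zeta_reg \<circ> (\<lambda>s. 1 - s)) holomorphic_on {s. Re s < 0}"
      by (rule holomorphic_on_compose_gen[OF _ zeta_reg_holomorphic]) (auto intro!: holomorphic_intros)
    moreover have "zeta_factor holomorphic_on {s. Re s < 0}"
      by (rule holomorphic_on_subset[OF zeta_factor_holomorphic]) auto
    ultimately have "(\<lambda>s. zeta_factor s * (zeta_reg (1 - s) / (- s))) holomorphic_on {s. Re s < 0}"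
      by (intro holomorphic_intros) (auto simp: o_def)
    then show "zeta_cont holomorphic_on {s. Re s < 0}"
      by (rule holomorphic_transform) (simp add: zeta_cont_reflect)
  qed (auto intro: open_halfspace_Re_gt open_halfspace_Re_lt open_Diff)
  moreover have "- {1} \<subseteq> ({s::complex. Re s > - 1} - {1}) \<union> {s. Re s < 0}" by auto
  ultimately show ?thesis by (rule holomorphic_on_subset)
qed

text \<open>Any two candidates agree for \<open>Re s > 1\<close>, hence on the punctured plane,
  which is connected, by the identity theorem; at 1 both are 0.\<close>

lemma zeta_eq_zeta_cont: "zeta = zeta_cont"
proof -
  let ?P = "\<lambda>h. h holomorphic_on (- {1}) \<and>
             (\<forall>s. Re s > 1 \<longrightarrow> (\<lambda>n. of_nat (Suc n) powr (- s)) sums h s) \<and> h 1 = 0"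
  have sums: "(\<lambda>n. of_nat (Suc n) powr (- s)) sums zeta_cont s" if "Re s > 1" for s
  proof -
    have "s - 1 \<noteq> 0" using that by auto
    then have "zeta_cont s = (\<Sum>n. of_nat (Suc n) powr (- s))"
      using that zeta_reg_eq_Dirichlet[OF that] by (simp add: zeta_cont_def)
    then show ?thesis
      using summable_sums[OF summable_norm_cancel[OF summable_norm_powr_nat[OF that]]] by simp
  qed
  have P: "?P zeta_cont"
    using zeta_cont_holomorphic sums by (auto simp: zeta_cont_def)
  have "h = zeta_cont" if h: "?P h" for h
  proof
    fix s
    show "h s = zeta_cont s"
    proof (cases "s = 1")
      case False
      have "h s - zeta_cont s = 0"
      proof (rule analytic_continuation_open[where s = "{s. Re s > 1}" and s' = "- {1}" and g = "\<lambda>_. 0" and f = "\<lambda>s. h s - zeta_cont s"])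
        show "connected (- {1 :: complex})"
          by (rule connected_punctured_universe) simp
        show "{s::complex. Re s > 1} \<noteq> {}"
        proof -
          have "2 \<in> {s::complex. Re s > 1}" by simp
          then show ?thesis by blast
        qed
        show "h z - zeta_cont z = 0" if "z \<in> {s. Re s > 1}" for z
          using h sums[of z] that sums_unique2 by fastforce
      qed (use h P False in \<open>auto intro!: holomorphic_intros open_halfspace_Re_gt\<close>)
      then show ?thesis by simp
    qed (use h P in simp)
  qed
  with P show ?thesis unfolding zeta_def by (rule the_equality)
qed

lemma zeta_eq: "Re s > - 1 \<Longrightarrow> zeta s = zeta_reg s / (s - 1)"
  by (simp add: zeta_eq_zeta_cont zeta_cont_def)

section \<open>The Riemann Hypothesis and the motion\<close>

text \<open>Passing to \<open>zeta_reg\<close> treats the pole on a par with the other points of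
  \<open>Omega\<close>. In the critical strip its zeros are those of zeta, and \<open>s\<close> is a
  zero if \<open>1 - s\<close> is one and conversely, as \<open>zeta_factor\<close> has no zeros
  there.\<close>

lemma Riemann_Hypothesis_iff:
  "Riemann_Hypothesis \<longleftrightarrow> (\<forall>s\<in>Omega. zeta_reg s \<noteq> 0)"
proof
  assume RH: Riemann_Hypothesis
  show "\<forall>s\<in>Omega. zeta_reg s \<noteq> 0"
  proof
    fix s assume s: "s \<in> Omega"
    show "zeta_reg s \<noteq> 0"
    proof (cases "Re s < 1")
      case True
      then have "zeta s \<noteq> 0"
        using RH s unfolding Riemann_Hypothesis_def Omega_def by force
      then show ?thesis using zeta_eq[of s] s by (auto simp: Omega_def)
    qed (use zeta_reg_nonzero_Re_ge_1 in auto)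
  qed
next
  assume nz: "\<forall>s\<in>Omega. zeta_reg s \<noteq> 0"
  show Riemann_Hypothesis
    unfolding Riemann_Hypothesis_def
  proof (intro allI impI)
    fix s assume s: "0 < Re s \<and> Re s < 1 \<and> zeta s = 0"
    then have "s - 1 \<noteq> 0" by auto
    then have z: "zeta_reg s = 0" using zeta_eq[of s] s by simp
    have "\<not> Re s > 1 / 2"
      using nz z s by (auto simp: Omega_def)
    moreover have "\<not> Re s < 1 / 2"
    proof
      assume "Re s < 1 / 2"
      then have "1 - s \<in> Omega" using s by (auto simp: Omega_def)
      then have "zeta_factor s * (1 - s) * zeta_reg (1 - s) \<noteq> 0"
        using nz zeta_factor_nonzero[of s] s \<open>s - 1 \<noteq> 0\<close> by auto
      then show False using zeta_reg_functional_equation[of s] s z by simp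
    qed
    ultimately show "Re s = 1 / 2" by linarith
  qed
qed

text \<open>A single quotient for \<open>1 / zeta\<close> that is holomorphic across the pole: at 1
  it is 0, the inverse of \<open>Infinity\<close>.\<close>

lemma sphere_inverse_zeta_sphere:
  assumes "s \<in> Omega"
  shows "sphere_inverse (zeta_sphere s) = (if zeta_reg s = 0 then Infinity else Finite ((s - 1) / zeta_reg s))"
  using assms zeta_eq[of s] zeta_reg_1 by (auto simp: zeta_sphere_def Omega_def)

theorem theorem6p2:
  shows "(Riemann_Hypothesis \<longleftrightarrow> holomorphic_motion Omega 1 plane zeta_motion) \<and>
         (holomorphic_motion Omega 1 plane zeta_motion \<longleftrightarrow>
            holomorphic_motion_in_plane Omega 1 plane zeta_motion)"
proof -
  have a_c: "holomorphic_motion_in_plane Omega 1 plane zeta_motion" if Riemann_Hypothesis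
  proof -
    from that have nz: "zeta_reg s \<noteq> 0" if "s \<in> Omega" for s
      using that by (simp add: Riemann_Hypothesis_iff)
    have opn: "open Omega"
    proof -
      have "Omega = {s. Re s > 1 / 2} \<inter> {s. Re s < 3 / 2}" by (auto simp: Omega_def)
      moreover have "open ({s. Re s > 1 / 2} \<inter> {s. Re s < 3 / 2})"
        by (intro open_Int open_halfspace_Re_gt open_halfspace_Re_lt)
      ultimately show ?thesis by (simp only:)
    qed
    have one: "1 \<in> Omega" by (simp add: Omega_def)
    \<comment> \<open>Without zeros of \<open>zeta_reg\<close> every parameter acts as translation
      by a finite number, so injectivity and finiteness of the values are immediate.\<close>
    have f: "zeta_motion s (Finite z) = Finite (z + (s - 1) / zeta_reg s)" if "s \<in> Omega" for s z
      using sphere_inverse_zeta_sphere[OF that] nz[OF that] by (simp add: zeta_motion_def)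
    have "zeta_reg holomorphic_on Omega"
      by (rule holomorphic_on_subset[OF zeta_reg_holomorphic]) (auto simp: Omega_def)
    then have "(\<lambda>s. z + (s - 1) / zeta_reg s) holomorphic_on Omega" for z
      using nz by (intro holomorphic_intros) auto
    then have hol: "holomorphic_to_sphere (\<lambda>s. zeta_motion s (Finite z)) Omega" for z
      unfolding holomorphic_to_sphere_def using opn f by blast
    show ?thesis
      unfolding holomorphic_motion_in_plane_def holomorphic_motion_def
      using opn one f hol by (auto simp: inj_on_def)
  qed
  have b_a: Riemann_Hypothesis if m: "holomorphic_motion Omega 1 plane zeta_motion"
    unfolding Riemann_Hypothesis_iff
  proof
    fix s assume s: "s \<in> Omega"
    show "zeta_reg s \<noteq> 0"
    proof
      assume "zeta_reg s = 0"
      \<comment> \<open>At a zero of zeta every finite point is sent to \<open>Infinity\<close>, so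
        0 and 1 collide.\<close>
      then have "zeta_motion s (Finite 0) = zeta_motion s (Finite 1)"
        using sphere_inverse_zeta_sphere[OF s] by (simp add: zeta_motion_def)
      moreover have "inj_on (zeta_motion s) plane"
        using m s by (simp add: holomorphic_motion_def)
      ultimately have "Finite 0 = Finite 1"
        by (meson inj_onD rangeI)
      then show False by simp
    qed
  qed
  show ?thesis
    \<comment> \<open>A motion in the plane is by definition a motion in the sphere, which closes
      the cycle of implications.\<close>
    using a_c b_a by (auto simp: holomorphic_motion_in_plane_def)
qed

end
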